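(* Let $(P_n)_{n\ge n_0}$ be a well-behaved RAP-sequence with common parameters $k$ and $m$. Then there is a rational function $f(x)$ in one variable such that (1) every real zero $x$ of the denominator of $f$ satisfies $x<k$, and (2) $E(P_n)=f(n)$ for every $n\ge n_0$.
   Context: A $k$-assignment in an $m\times n$ matrix ($\min(m,n)\ge k$) is a set of $k$ positions, no two in the same row or column; its cost is the sum of the entries there; for a random matrix $P$, $E(P)$ is the expected minimal cost of a $k$-assignment. An exponential RAP is such a problem in which every matrix entry is a linear combination with nonnegative rational coefficients of a fixed finite family $X_1,\dots,X_p$ of independent exponentially distributed random variables (with various intensities; $X$ has intensity $a$ if $\Pr(X>t)=e^{-at}$). Entries that are identically $0$ (all coefficients $0$) are called zeros. A variable $X_i$ is standard if it has intensity $1$, occurs (with nonzero coefficient) in exactly one matrix position, and the entry at that position equals $X_i$; that position is then called standard. A linear function $g(x)=ax+b$ is $k$-positive if $g(x)>0$ for all $x\ge k$ (equivalently $a\ge0$ and $b>-ak$). An RAP-sequence is a sequence $(P_n)_{n\ge n_0}$ of exponential RAPs such that: (1) $P_n$ is an exponential RAP in variables $X_{n,1},\dots,X_{n,p(n)}$; (2) all $P_n$ have the same $m$ and $k$, and $P_n$ has $n$ columns; (3) in the first $n_0$ columns the entries of the various $P_n$ differ only in the first index of the variables, i.e. the coefficient of $X_{n,i}$ in an entry in the first $n_0$ columns of $P_n$ equals the coefficient of $X_{n_0,i}$ at the same position of $P_{n_0}$; (4) beyond column $n_0$, every entry of $P_n$ is standard. It is well-behaved if moreover: (a) for each $i$ such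 that the variables $X_{n,i}$ occur in the first $n_0$ columns, there is a $k$-positive linear polynomial $f_i$ with the intensity of $X_{n,i}$ equal to $f_i(n)$ for all $n$; (b) nonzero nonstandard entries occur only in columns belonging to the column-maximal optimal cover of the zeros, i.e. columns that belong to some minimum-cardinality set of rows and columns covering all zero positions (equivalently, columns meeting every maximum set of independent zeros). *)

theory Defs
  imports "HOL-Probability.Probability" "HOL-Computational_Algebra.Polynomial"
begin

text \<open>
  Rows, columns and variables are numbered from 1. The coefficient of the variable \<open>X\<^sub>i\<close> in the
  matrix entry at position \<open>(r, c)\<close> is \<open>coef P (r, c) i\<close>.
\<close>

record 'a rap =
  prspace :: "'a measure"
  num_rows :: nat
  num_cols :: nat
  asg_size :: nat
  num_vars :: nat
  var :: "nat \<Rightarrow> 'a \<Rightarrow> real"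
  intensity :: "nat \<Rightarrow> real"
  coef :: "nat \<times> nat \<Rightarrow> nat \<Rightarrow> rat"

definition positions :: "'a rap \<Rightarrow> (nat \<times> nat) set" where
  "positions P = {1..num_rows P} \<times> {1..num_cols P}"

text \<open>
  The last clause is only a normal form: numbers that do not name one of the variables of \<open>P\<close> carry
  the coefficient 0, so that coefficients can be compared between RAPs with different numbers of
  variables.
\<close>

definition exponential_rap :: "'a rap \<Rightarrow> bool" where
  "exponential_rap P \<longleftrightarrow>
     prob_space (prspace P) \<and>
     asg_size P \<le> min (num_rows P) (num_cols P) \<and>
     prob_space.indep_vars (prspace P) (\<lambda>_. borel) (var P) {1..num_vars P} \<and>
     (\<forall>i\<in>{1..num_vars P}. 0 < intensity P i \<and>
        distributed (prspace P) lborel (var P i) (exponential_density (intensity P i))) \<and>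
     (\<forall>pos\<in>positions P. \<forall>i\<in>{1..num_vars P}. 0 \<le> coef P pos i) \<and>
     (\<forall>pos\<in>positions P. \<forall>i. i \<notin> {1..num_vars P} \<longrightarrow> coef P pos i = 0)"

definition entry :: "'a rap \<Rightarrow> nat \<times> nat \<Rightarrow> 'a \<Rightarrow> real" where
  "entry P pos \<omega> = (\<Sum>i=1..num_vars P. of_rat (coef P pos i) * var P i \<omega>)"

definition assignments :: "'a rap \<Rightarrow> (nat \<times> nat) set set" where
  "assignments P =
     {S. S \<subseteq> positions P \<and> card S = asg_size P \<and> inj_on fst S \<and> inj_on snd S}"

definition min_cost :: "'a rap \<Rightarrow> 'a \<Rightarrow> real" where
  "min_cost P \<omega> = Min ((\<lambda>S. \<Sum>pos\<in>S. entry P pos \<omega>) ` assignments P)"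

definition expected_min_cost :: "'a rap \<Rightarrow> real" where
  "expected_min_cost P = prob_space.expectation (prspace P) (min_cost P)"

definition is_zero :: "'a rap \<Rightarrow> nat \<times> nat \<Rightarrow> bool" where
  "is_zero P pos \<longleftrightarrow> pos \<in> positions P \<and> (\<forall>i\<in>{1..num_vars P}. coef P pos i = 0)"

definition occurs_at :: "'a rap \<Rightarrow> nat \<Rightarrow> nat \<times> nat \<Rightarrow> bool" where
  "occurs_at P i pos \<longleftrightarrow> pos \<in> positions P \<and> i \<in> {1..num_vars P} \<and> coef P pos i \<noteq> 0"

definition standard_var :: "'a rap \<Rightarrow> nat \<Rightarrow> bool" where
  "standard_var P i \<longleftrightarrow> i \<in> {1..num_vars P} \<and> intensity P i = 1 \<and>
     (\<exists>!pos. occurs_at P i pos) \<and>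
     (\<forall>pos. occurs_at P i pos \<longrightarrow>
        (\<forall>j\<in>{1..num_vars P}. coef P pos j = (if j = i then 1 else 0)))"

definition standard_pos :: "'a rap \<Rightarrow> nat \<times> nat \<Rightarrow> bool" where
  "standard_pos P pos \<longleftrightarrow> (\<exists>i. standard_var P i \<and> occurs_at P i pos)"

definition zero_cover :: "'a rap \<Rightarrow> nat set \<Rightarrow> nat set \<Rightarrow> bool" where
  "zero_cover P R C \<longleftrightarrow> R \<subseteq> {1..num_rows P} \<and> C \<subseteq> {1..num_cols P} \<and>
     (\<forall>r c. is_zero P (r, c) \<longrightarrow> r \<in> R \<or> c \<in> C)"

definition optimal_zero_cover :: "'a rap \<Rightarrow> nat set \<Rightarrow> nat set \<Rightarrow> bool" where
  "optimal_zero_cover P R C \<longleftrightarrow> zero_cover P R C \<and>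
     (\<forall>R' C'. zero_cover P R' C' \<longrightarrow> card R + card C \<le> card R' + card C')"

text \<open>
  The columns of the column-maximal optimal cover: its column set is the union of the column sets of
  all optimal covers.
\<close>

definition column_maximal_columns :: "'a rap \<Rightarrow> nat set" where
  "column_maximal_columns P = \<Union> {C. \<exists>R. optimal_zero_cover P R C}"

definition k_positive :: "nat \<Rightarrow> real poly \<Rightarrow> bool" where
  "k_positive k g \<longleftrightarrow> degree g \<le> 1 \<and> (\<forall>x\<ge>real k. poly g x > 0)"

text \<open>
  A sequence is indexed by all natural numbers, but its members below \<open>n\<^sub>0\<close> are irrelevant. Only
  the coefficients are compared in the first \<open>n\<^sub>0\<close> columns: the intensities of corresponding
  variables may depend on \<open>n\<close>.
\<close>

definition rap_sequence :: "nat \<Rightarrow> nat \<Rightarrow> nat \<Rightarrow> (nat \<Rightarrow> 'a rap) \<Rightarrow> bool" where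
  "rap_sequence k m n0 P \<longleftrightarrow> (\<forall>n\<ge>n0.
     exponential_rap (P n) \<and>
     num_rows (P n) = m \<and> num_cols (P n) = n \<and> asg_size (P n) = k \<and>
     (\<forall>pos\<in>{1..m} \<times> {1..n0}. \<forall>i. coef (P n) pos i = coef (P n0) pos i) \<and>
     (\<forall>pos\<in>{1..m} \<times> {n0<..n}. standard_pos (P n) pos))"

definition well_behaved :: "nat \<Rightarrow> nat \<Rightarrow> nat \<Rightarrow> (nat \<Rightarrow> 'a rap) \<Rightarrow> bool" where
  "well_behaved k m n0 P \<longleftrightarrow> rap_sequence k m n0 P \<and>
     (\<forall>i. (\<exists>pos\<in>{1..m} \<times> {1..n0}. occurs_at (P n0) i pos) \<longrightarrow>
        (\<exists>f. k_positive k f \<and> (\<forall>n\<ge>n0. intensity (P n) i = poly f (real n)))) \<and>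
     (\<forall>n\<ge>n0. \<forall>r c. (r, c) \<in> positions (P n) \<and> \<not> is_zero (P n) (r, c) \<and>
        \<not> standard_pos (P n) (r, c) \<longrightarrow> c \<in> column_maximal_columns (P n))"

end

theory Submission
  imports Defs
begin

text \<open>
  Let \<open>M\<close> be a maximum matching of zeros. By Koenig's theorem its set of columns \<open>D\<close> contains every
  column of an optimal cover, so all entries outside \<open>D\<close> are zero or standard. If \<open>M\<close> has at least
  \<open>k\<close> edges, the minimal cost is 0. Otherwise exchanging edges with \<open>M\<close> shows that some minimal
  assignment uses all columns of \<open>D\<close>, hence only \<open>k - card D\<close> others, so that only the
  \<open>k - card D\<close> smallest entries outside \<open>D\<close> of each row matter. Reveal these in increasing order.
  When \<open>j\<close> of the entries of a row outside \<open>D\<close> are known, the gap to the next one is exponential of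
  rate \<open>n - card D - j > n - k\<close>, and it is equally likely to be in each remaining column. The columns
  beyond \<open>n0\<close> are interchangeable, so finitely many patterns occur, with weights that are rational
  in \<open>n\<close> without poles in \<open>[k, \<infinity>)\<close>.

  In the end the cost is the minimum of finitely many linear forms in independent exponential
  variables whose rates are rational and positive on \<open>[k, \<infinity>)\<close>. Two forms are compared by letting
  suitable pairs of variables race; this brings in only sums of rates as denominators.
\<close>

text \<open>The difficulty is the bound \<open>k\<close> on the poles. The number of variables grows
  with \<open>n\<close>, so the mean has to be reduced to a computation of fixed size, and every
  division on the way must be by a function that is positive at all real \<open>x >= k\<close>, not
  only at the integers \<open>n >= n0\<close>. This is why the assignment is forced through all
  columns of \<open>D\<close>. Otherwise up to \<open>k\<close> entries outside \<open>D\<close>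
  would have to be revealed in a row, and the rates \<open>n - card D - j\<close> with
  \<open>j\<close> up to \<open>k - 1\<close> could vanish at points \<open>x >= k\<close>. With
  only \<open>k - card D\<close> of them, \<open>card D + j\<close> stays below \<open>k\<close>.

  A single \<open>M\<close> serves the whole sequence: entries beyond column \<open>n0\<close> are
  standard, hence not zeros, so all members have the same zeros.

  Geometrically, a race splits the orthant along the hyperplane on which two coordinates agree, and
  parametrizes each half by an orthant again. After finitely many scalings and splittings every
  piece has one form that is smallest throughout, and only means of single linear forms
  remain.\<close>

section \<open>Products of exponential distributions\<close>

text \<open>
  The value at rates \<open>l \<le> 0\<close> is arbitrary; it makes \<open>expo l\<close> a probability space for all \<open>l\<close>.
\<close>
definition expo :: "real \<Rightarrow> real measure" where
  "expo l = density lborel (exponential_density (if 0 < l then l else 1))"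

definition expo_prod :: "'i set \<Rightarrow> ('i \<Rightarrow> real) \<Rightarrow> ('i \<Rightarrow> real) measure" where
  "expo_prod I \<rho> = Pi\<^sub>M I (\<lambda>i. expo (\<rho> i))"

lemma sets_expo [measurable_cong, simp]: "sets (expo l) = sets borel"
  by (simp add: expo_def)

lemma space_expo [simp]: "space (expo l) = UNIV"
  by (simp add: expo_def)

lemma prob_space_expo: "prob_space (expo l)"
  unfolding expo_def by (rule prob_space_exponential_density) simp

lemma sets_expo_prod [measurable_cong, simp]: "sets (expo_prod I \<rho>) = sets (Pi\<^sub>M I (\<lambda>_. borel))"
  unfolding expo_prod_def by (rule sets_PiM_cong) auto

lemma space_expo_prod: "space (expo_prod I \<rho>) = PiE I (\<lambda>_. UNIV)"
  by (simp add: expo_prod_def space_PiM)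

interpretation expo: product_prob_space "\<lambda>i. expo (\<rho> i)" I for \<rho> :: "'i \<Rightarrow> real" and I
  by (simp add: product_prob_space_def product_prob_space_axioms_def product_sigma_finite_def
      prob_space_expo prob_space_imp_sigma_finite)

lemma prob_space_expo_prod: "prob_space (expo_prod I \<rho>)"
  unfolding expo_prod_def by (intro prob_space_PiM prob_space_expo)

lemma expo_prod_cong: "(\<And>i. i \<in> I \<Longrightarrow> \<rho> i = \<rho>' i) \<Longrightarrow> expo_prod I \<rho> = expo_prod I \<rho>'"
  unfolding expo_prod_def by (rule PiM_cong) auto

lemma expo_prod_fun_upd: "a \<notin> I \<Longrightarrow> expo_prod I (\<rho>(a := r)) = expo_prod I \<rho>"
  by (rule expo_prod_cong) auto

lemma AE_expo_nonneg: "AE x in expo l. 0 \<le> x"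
  unfolding expo_def by (subst AE_density) (auto simp: exponential_density_def)

lemma AE_expo_neq: "AE x in expo l. x \<noteq> c"
proof -
  have "AE x in lborel. x \<noteq> c"
    by (rule AE_lborel_singleton)
  then show ?thesis
    unfolding expo_def by (subst AE_density) auto
qed

lemma AE_expo_prod_nonneg:
  assumes "finite I"
  shows "AE x in expo_prod I \<rho>. \<forall>i\<in>I. 0 \<le> x i"
  unfolding expo_prod_def using assms
  by (intro AE_finite_allI AE_PiM_component[of I "\<lambda>i. expo (\<rho> i)"] prob_space_expo AE_expo_nonneg) auto

lemma nn_integral_expo_prod_insert:
  assumes "finite I" "a \<in> I" "F \<in> borel_measurable (Pi\<^sub>M I (\<lambda>_. borel))"
  shows "(\<integral>\<^sup>+x. F x \<partial>expo_prod I \<rho>) =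
         (\<integral>\<^sup>+x. (\<integral>\<^sup>+y. F (x(a := y)) \<partial>expo (\<rho> a)) \<partial>expo_prod (I - {a}) \<rho>)"
proof -
  have I: "insert a (I - {a}) = I" using assms by auto
  have "F \<in> borel_measurable (Pi\<^sub>M I (\<lambda>i. expo (\<rho> i)))"
    using assms(3) by (simp cong: measurable_cong_sets sets_PiM_cong)
  then show ?thesis
    using expo.product_nn_integral_insert[of "I - {a}" a F \<rho>, unfolded I] assms(1)
    by (simp add: expo_prod_def)
qed

lemma nn_integral_expo_prod_insert_rev:
  assumes "finite I" "a \<in> I" "F \<in> borel_measurable (Pi\<^sub>M I (\<lambda>_. borel))"
  shows "(\<integral>\<^sup>+x. F x \<partial>expo_prod I \<rho>) =
         (\<integral>\<^sup>+y. (\<integral>\<^sup>+x. F (x(a := y)) \<partial>expo_prod (I - {a}) \<rho>) \<partial>expo (\<rho> a))"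
proof -
  have I: "insert a (I - {a}) = I" using assms by auto
  have "F \<in> borel_measurable (Pi\<^sub>M I (\<lambda>i. expo (\<rho> i)))"
    using assms(3) by (simp cong: measurable_cong_sets sets_PiM_cong)
  then show ?thesis
    using expo.product_nn_integral_insert_rev[of "I - {a}" a F \<rho>, unfolded I] assms(1)
    by (simp add: expo_prod_def)
qed

lemma AE_expo_prod_neq:
  assumes "finite I" "a \<in> I" "b \<in> I" "a \<noteq> b"
  shows "AE x in expo_prod I \<rho>. x a \<noteq> x b"
proof -
  have [measurable]: "(\<lambda>x. x a) \<in> borel_measurable (Pi\<^sub>M I (\<lambda>_. borel))"
    "(\<lambda>x. x b) \<in> borel_measurable (Pi\<^sub>M I (\<lambda>_. borel))"
    using assms by (auto intro: measurable_component_singleton)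
  have "Measurable.pred (Pi\<^sub>M I (\<lambda>_. borel)) (\<lambda>x. x a = (x b :: real))"
    unfolding pred_def by measurable
  then have ind [measurable]: "(\<lambda>x. indicator {x. x a = (x b :: real)} x :: ennreal) \<in> borel_measurable (Pi\<^sub>M I (\<lambda>_. borel))"
    by (intro borel_measurable_indicator') (simp add: pred_def)
  have "(\<integral>\<^sup>+x. indicator {x. x a = x b} x \<partial>expo_prod I \<rho>) =
     (\<integral>\<^sup>+x. (\<integral>\<^sup>+y. indicator {x. x a = x b} (x(a := y)) \<partial>expo (\<rho> a)) \<partial>expo_prod (I - {a}) \<rho>)"
    by (rule nn_integral_expo_prod_insert) (use assms(1,2) ind in auto)
  also have "\<dots> = (\<integral>\<^sup>+x. 0 \<partial>expo_prod (I - {a}) \<rho>)"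
  proof (rule nn_integral_cong)
    fix x :: "'a \<Rightarrow> real"
    show "(\<integral>\<^sup>+y. indicator {x. x a = x b} (x(a := y)) \<partial>expo (\<rho> a)) = (0::ennreal)"
      using AE_expo_neq[of "x b" "\<rho> a"] assms(4)
      by (subst nn_integral_0_iff_AE) (auto simp: indicator_def)
  qed
  finally have "(\<integral>\<^sup>+x. indicator {x. x a = x b} x \<partial>expo_prod I \<rho>) = 0" by simp
  then have "AE x in expo_prod I \<rho>. indicator {x. x a = x b} x = (0::ennreal)"
    by (subst (asm) nn_integral_0_iff_AE) auto
  then show ?thesis by (auto simp: indicator_def elim!: eventually_mono split: if_splits)
qed

section \<open>Memorylessness and races\<close>

lemma nn_integral_expo:
  assumes "0 < l" "f \<in> borel_measurable borel"
  shows "(\<integral>\<^sup>+x. f x \<partial>expo l) = (\<integral>\<^sup>+x. ennreal (exponential_density l x) * f x \<partial>lborel)"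
  unfolding expo_def using assms by (simp add: nn_integral_density)

lemma nn_integral_expo_shift:
  assumes l: "0 < l" and t: "0 \<le> t" and [measurable]: "f \<in> borel_measurable borel"
  shows "(\<integral>\<^sup>+x. indicator {t<..} x * f x \<partial>expo l) = ennreal (exp (- l * t)) * (\<integral>\<^sup>+x. f (t + x) \<partial>expo l)"
proof -
  have "(\<integral>\<^sup>+x. indicator {t<..} x * f x \<partial>expo l) =
      (\<integral>\<^sup>+x. ennreal (exponential_density l x) * (indicator {t<..} x * f x) \<partial>lborel)"
    by (rule nn_integral_expo) (use l in auto)
  also have "\<dots> = (\<integral>\<^sup>+x. ennreal (exponential_density l (t + x)) * (indicator {t<..} (t + x) * f (t + x)) \<partial>lborel)"
    using nn_integral_real_affine[of "\<lambda>x. ennreal (exponential_density l x) * (indicator {t<..} x * f x)" 1 t] by simp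
  also have "\<dots> = (\<integral>\<^sup>+x. ennreal (exp (- l * t)) * (ennreal (exponential_density l x) * f (t + x)) \<partial>lborel)"
  \<comment> \<open>The sides may differ at \<open>x = 0\<close>: the strict indicator vanishes at
    \<open>t\<close>, whereas the density of rate \<open>l\<close> at 0 is \<open>l\<close>.\<close>
  proof (rule nn_integral_cong_AE)
    have "AE x in lborel. x \<noteq> (0::real)" by (rule AE_lborel_singleton)
    then show "AE x in lborel. ennreal (exponential_density l (t + x)) * (indicator {t<..} (t + x) * f (t + x)) =
       ennreal (exp (- l * t)) * (ennreal (exponential_density l x) * f (t + x))"
    proof eventually_elim
      case (elim x)
      show ?case
      proof (cases "0 < x")
        case True
        have "exponential_density l (t + x) = exp (- l * t) * exponential_density l x"
          using True t by (simp add: exponential_density_def exp_add[symmetric] algebra_simps)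
        then show ?thesis
          using True l by (simp add: ennreal_mult' exponential_density_nonneg mult.assoc)
      qed (use elim in \<open>auto simp: exponential_density_def\<close>)
    qed
  qed
  also have "\<dots> = ennreal (exp (- l * t)) * (\<integral>\<^sup>+x. f (t + x) \<partial>expo l)"
    by (simp add: nn_integral_cmult nn_integral_expo[OF l])
  finally show ?thesis .
qed

lemma measurable_self_map:
  assumes "\<And>i. i \<in> I \<Longrightarrow> (\<lambda>x. f x i) \<in> borel_measurable (Pi\<^sub>M I (\<lambda>_. borel))"
    and "\<And>x i. x \<in> extensional I \<Longrightarrow> i \<notin> I \<Longrightarrow> f x i = undefined"
  shows "f \<in> Pi\<^sub>M I (\<lambda>_. borel :: real measure) \<rightarrow>\<^sub>M Pi\<^sub>M I (\<lambda>_. borel :: real measure)"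
  using assms by (intro measurable_PiM_single') (auto simp: space_PiM PiE_def extensional_def)

lemma measurable_single_shift:
  assumes "a \<in> I" "t \<in> borel_measurable (Pi\<^sub>M I (\<lambda>_. borel))"
  shows "(\<lambda>x. x(a := t x)) \<in> Pi\<^sub>M I (\<lambda>_. borel :: real measure) \<rightarrow>\<^sub>M Pi\<^sub>M I (\<lambda>_. borel :: real measure)"
  using assms by (intro measurable_self_map) (auto simp: extensional_def fun_upd_def)

lemma nn_integral_expo_prod_shift1:
  assumes I: "finite I" "a \<in> I" and l: "0 < \<rho> a" and t: "0 \<le> t"
    and F: "F \<in> borel_measurable (Pi\<^sub>M I (\<lambda>_. borel))"
  shows "(\<integral>\<^sup>+x. indicator {t<..} (x a) * F x \<partial>expo_prod I \<rho>) =
     ennreal (exp (- \<rho> a * t)) * (\<integral>\<^sup>+x. F (x(a := t + x a)) \<partial>expo_prod I \<rho>)"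
proof -
  have Ia: "insert a (I - {a}) = I" using I by auto
  have [measurable]: "(\<lambda>x. x a) \<in> borel_measurable (Pi\<^sub>M I (\<lambda>_. borel))"
    using I by (auto intro: measurable_component_singleton)
  note F[measurable]
  have upd: "(\<lambda>x. x(a := t + x a)) \<in> Pi\<^sub>M I (\<lambda>_. borel) \<rightarrow>\<^sub>M Pi\<^sub>M I (\<lambda>_. borel)"
    using I by (intro measurable_single_shift) auto
  have m2: "(\<lambda>(x, y). F (x(a := t + y))) \<in> borel_measurable (Pi\<^sub>M (I - {a}) (\<lambda>_. borel) \<Otimes>\<^sub>M borel)"
  proof -
    have "(\<lambda>(x, y). x(a := t + y)) \<in> (Pi\<^sub>M (I - {a}) (\<lambda>_. borel) \<Otimes>\<^sub>M borel) \<rightarrow>\<^sub>M Pi\<^sub>M (insert a (I - {a})) (\<lambda>_. borel)"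
      by measurable
    then show ?thesis
      using F unfolding Ia by (auto simp: case_prod_unfold intro: measurable_compose)
  qed
  have m3: "(\<lambda>y. F (x(a := y))) \<in> borel_measurable borel" if "x \<in> space (expo_prod (I - {a}) \<rho>)" for x
  proof -
    have "(\<lambda>y. x(a := y)) \<in> borel \<rightarrow>\<^sub>M Pi\<^sub>M (insert a (I - {a})) (\<lambda>_. borel)"
      using that by (intro measurable_PiM_single') (auto simp: space_expo_prod PiE_def extensional_def)
    then show ?thesis using F unfolding Ia by (rule measurable_compose)
  qed
  have "(\<integral>\<^sup>+x. indicator {t<..} (x a) * F x \<partial>expo_prod I \<rho>) =
      (\<integral>\<^sup>+x. (\<integral>\<^sup>+y. indicator {t<..} y * F (x(a := y)) \<partial>expo (\<rho> a)) \<partial>expo_prod (I - {a}) \<rho>)"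
    by (subst nn_integral_expo_prod_insert[OF I]) auto
  also have "\<dots> = (\<integral>\<^sup>+x. ennreal (exp (- \<rho> a * t)) * (\<integral>\<^sup>+y. F (x(a := t + y)) \<partial>expo (\<rho> a)) \<partial>expo_prod (I - {a}) \<rho>)"
    by (intro nn_integral_cong nn_integral_expo_shift l t m3)
  also have "\<dots> = ennreal (exp (- \<rho> a * t)) * (\<integral>\<^sup>+x. (\<integral>\<^sup>+y. F (x(a := t + y)) \<partial>expo (\<rho> a)) \<partial>expo_prod (I - {a}) \<rho>)"
  proof (rule nn_integral_cmult)
    have "(\<lambda>(x, y). F (x(a := t + y))) \<in> borel_measurable (expo_prod (I - {a}) \<rho> \<Otimes>\<^sub>M expo (\<rho> a))"
      using m2 by (simp cong: measurable_cong_sets sets_pair_measure_cong)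
    then show "(\<lambda>x. \<integral>\<^sup>+y. F (x(a := t + y)) \<partial>expo (\<rho> a)) \<in> borel_measurable (expo_prod (I - {a}) \<rho>)"
      using sigma_finite_measure.borel_measurable_nn_integral[OF prob_space_imp_sigma_finite[OF prob_space_expo]] by simp
  qed
  also have "(\<integral>\<^sup>+x. (\<integral>\<^sup>+y. F (x(a := t + y)) \<partial>expo (\<rho> a)) \<partial>expo_prod (I - {a}) \<rho>) =
     (\<integral>\<^sup>+x. F (x(a := t + x a)) \<partial>expo_prod I \<rho>)"
    using nn_integral_expo_prod_insert[OF I measurable_compose[OF upd F]] by simp
  finally show ?thesis .
qed

text \<open>The one-coordinate shift is applied to one index of \<open>Q\<close> after the other.
  The shift \<open>t\<close> is a constant, so in a race the time of the winner has to be fixed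
  before its rivals are shifted.\<close>

lemma nn_integral_expo_prod_shift:
  assumes I: "finite I" "Q \<subseteq> I" and l: "\<And>i. i \<in> Q \<Longrightarrow> 0 < \<rho> i" and t: "0 \<le> t"
    and F: "F \<in> borel_measurable (Pi\<^sub>M I (\<lambda>_. borel))"
  shows "(\<integral>\<^sup>+x. indicator {x. \<forall>i\<in>Q. t < x i} x * F x \<partial>expo_prod I \<rho>) =
     ennreal (exp (- (\<Sum>i\<in>Q. \<rho> i) * t)) * (\<integral>\<^sup>+x. F (\<lambda>i. if i \<in> Q then t + x i else x i) \<partial>expo_prod I \<rho>)"
proof -
  have "finite Q" using I finite_subset by auto
  then show ?thesis using I(2) l F
  proof (induction Q arbitrary: F rule: finite_induct)
    case empty
    then show ?case by simp
  next
    case (insert a Q)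
    note F = insert.prems(3)
    have [measurable]: "(\<lambda>x. x i) \<in> borel_measurable (Pi\<^sub>M I (\<lambda>_. borel))" if "i \<in> I" for i
      using that by (auto intro: measurable_component_singleton)
    have [measurable]: "F \<in> borel_measurable (Pi\<^sub>M I (\<lambda>_. borel))" "a \<in> I" by fact (use insert in auto)
    let ?S = "\<lambda>x i. if i \<in> Q then t + x i else x i :: real"
    have S: "?S \<in> Pi\<^sub>M I (\<lambda>_. borel) \<rightarrow>\<^sub>M Pi\<^sub>M I (\<lambda>_. borel)"
      using insert.prems by (intro measurable_self_map) (auto simp: extensional_def)
    have "(\<integral>\<^sup>+x. indicator {x. \<forall>i\<in>insert a Q. t < x i} x * F x \<partial>expo_prod I \<rho>) =
       (\<integral>\<^sup>+x. indicator {x. \<forall>i\<in>Q. t < x i} x * (indicator {t<..} (x a) * F x) \<partial>expo_prod I \<rho>)"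
      by (intro nn_integral_cong) (auto simp: indicator_def)
    also have "\<dots> = ennreal (exp (- (\<Sum>i\<in>Q. \<rho> i) * t)) *
        (\<integral>\<^sup>+x. indicator {t<..} (?S x a) * F (?S x) \<partial>expo_prod I \<rho>)"
      by (rule insert.IH) (use insert in auto)
    also have "(\<integral>\<^sup>+x. indicator {t<..} (?S x a) * F (?S x) \<partial>expo_prod I \<rho>) =
        (\<integral>\<^sup>+x. indicator {t<..} (x a) * F (?S x) \<partial>expo_prod I \<rho>)"
      using insert by simp
    also have "\<dots> = ennreal (exp (- \<rho> a * t)) * (\<integral>\<^sup>+x. F (?S (x(a := t + x a))) \<partial>expo_prod I \<rho>)"
      by (rule nn_integral_expo_prod_shift1[OF I(1)])
        (use insert t measurable_compose[OF S F] in auto)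
    also have "\<dots> = ennreal (exp (- \<rho> a * t)) *
      (\<integral>\<^sup>+x. F (\<lambda>i. if i \<in> insert a Q then t + x i else x i) \<partial>expo_prod I \<rho>)"
    proof -
      have "?S (x(a := t + x a)) = (\<lambda>i. if i \<in> insert a Q then t + x i else x i)" for x
        using insert.hyps by (auto simp: fun_eq_iff)
      then show ?thesis by (simp only:)
    qed
    also have "ennreal (exp (- (\<Sum>i\<in>Q. \<rho> i) * t)) * \<dots> =
       ennreal (exp (- (\<Sum>i\<in>insert a Q. \<rho> i) * t)) *
       (\<integral>\<^sup>+x. F (\<lambda>i. if i \<in> insert a Q then t + x i else x i) \<partial>expo_prod I \<rho>)"
    proof -
      have "exp (- (\<Sum>i\<in>Q. \<rho> i) * t) * exp (- \<rho> a * t) = exp (- (\<Sum>i\<in>insert a Q. \<rho> i) * t)"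
        using insert.hyps by (simp add: exp_add[symmetric] algebra_simps)
      then have "ennreal (exp (- (\<Sum>i\<in>Q. \<rho> i) * t)) * ennreal (exp (- \<rho> a * t)) =
         ennreal (exp (- (\<Sum>i\<in>insert a Q. \<rho> i) * t))"
        by (simp only: ennreal_mult'[symmetric] exp_ge_zero)
      then show ?thesis by (simp only: mult.assoc[symmetric])
    qed
    finally show ?case .
  qed
qed

text \<open>A linear map from the orthant onto the cone on which \<open>q\<close> attains the
  minimum over \<open>Q\<close>.\<close>

definition race_map :: "'i set \<Rightarrow> 'i \<Rightarrow> ('i \<Rightarrow> real) \<Rightarrow> 'i \<Rightarrow> real" where
  "race_map Q q y = (\<lambda>i. if i \<in> Q - {q} then y q + y i else y i)"

lemma measurable_race_map:
  assumes "Q \<subseteq> I" "q \<in> Q"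
  shows "race_map Q q \<in> Pi\<^sub>M I (\<lambda>_. borel) \<rightarrow>\<^sub>M Pi\<^sub>M I (\<lambda>_. borel)"
proof (rule measurable_self_map)
  fix i assume "i \<in> I"
  then have [measurable]: "(\<lambda>x. x i) \<in> borel_measurable (Pi\<^sub>M I (\<lambda>_. borel :: real measure))"
    "(\<lambda>x. x q) \<in> borel_measurable (Pi\<^sub>M I (\<lambda>_. borel :: real measure))"
    using assms by (auto intro: measurable_component_singleton)
  show "(\<lambda>x. race_map Q q x i) \<in> borel_measurable (Pi\<^sub>M I (\<lambda>_. borel))"
    unfolding race_map_def by measurable
qed (use assms in \<open>auto simp: race_map_def extensional_def\<close>)

text \<open>
  Memorylessness: the summand of \<open>q\<close> is the event that \<open>q\<close> wins the race. The new variable at index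
  \<open>q\<close> is then the minimum over \<open>Q\<close>, and those at the other indices in \<open>Q\<close> are the excesses over it.
\<close>
theorem nn_integral_expo_prod_race:
  assumes I: "finite I" "Q \<subseteq> I" and Q: "Q \<noteq> {}" and l: "\<And>i. i \<in> Q \<Longrightarrow> 0 < \<rho> i"
    and F: "F \<in> borel_measurable (Pi\<^sub>M I (\<lambda>_. borel))"
  shows "(\<integral>\<^sup>+x. F x \<partial>expo_prod I \<rho>) = (\<Sum>q\<in>Q. ennreal (\<rho> q / (\<Sum>i\<in>Q. \<rho> i)) *
           (\<integral>\<^sup>+y. F (race_map Q q y) \<partial>expo_prod I (\<rho>(q := \<Sum>i\<in>Q. \<rho> i))))"
proof -
  have fQ: "finite Q" using I finite_subset by auto
  let ?L = "\<Sum>i\<in>Q. \<rho> i"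
  have L: "0 < ?L" using fQ Q l by (intro sum_pos) auto
  note F [measurable]
  have comp [measurable]: "(\<lambda>x. x i) \<in> borel_measurable (Pi\<^sub>M I (\<lambda>_. borel))" if "i \<in> I" for i
    using that by (auto intro: measurable_component_singleton)
  let ?W = "\<lambda>q. indicator {x. \<forall>i\<in>Q - {q}. x q < x i} :: ('a \<Rightarrow> real) \<Rightarrow> ennreal"
  have W [measurable]: "?W q \<in> borel_measurable (Pi\<^sub>M I (\<lambda>_. borel))" if "q \<in> Q" for q
  proof -
    have "Measurable.pred (Pi\<^sub>M I (\<lambda>_. borel)) (\<lambda>x. \<forall>i\<in>Q - {q}. x q < (x i :: real))"
      using that I fQ by (intro pred_intros_finite borel_measurable_pred_less comp) auto
    then show ?thesis by simp
  qed
  \<comment> \<open>Ties have probability 0, so almost surely exactly one of the indicators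
    \<open>?W q\<close> is 1.\<close>
  have "AE x in expo_prod I \<rho>. \<forall>a\<in>Q. \<forall>b\<in>Q. a \<noteq> b \<longrightarrow> x a \<noteq> x b"
    using fQ I by (intro AE_finite_allI) (auto intro!: AE_expo_prod_neq AE_impI)
  then have AE: "AE x in expo_prod I \<rho>. F x = (\<Sum>q\<in>Q. ?W q x * F x)"
  proof eventually_elim
    case (elim x)
    obtain q where q: "q \<in> Q" "\<And>i. i \<in> Q \<Longrightarrow> x q \<le> x i"
      using ex_is_arg_min_if_finite[OF fQ Q, of x] by (auto simp: is_arg_min_linorder)
    have "?W p x = (if p = q then 1 else 0)" if "p \<in> Q" for p
    proof (cases "p = q")
      case True
      have "x q < x i" if "i \<in> Q" "i \<noteq> q" for i
        using q(1) q(2)[OF that(1)] elim that by (metis order_le_less)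
      with True show ?thesis by (simp add: indicator_def)
    next
      case False
      with q(1) q(2)[OF that] show ?thesis by (auto simp: indicator_def intro!: bexI[of _ q])
    qed
    then have "(\<Sum>p\<in>Q. ?W p x * F x) = (\<Sum>p\<in>Q. if p = q then F x else 0)"
      by (intro sum.cong) auto
    then show ?case using q fQ by (simp add: sum.delta')
  qed
  have "(\<integral>\<^sup>+x. F x \<partial>expo_prod I \<rho>) = (\<integral>\<^sup>+x. (\<Sum>q\<in>Q. ?W q x * F x) \<partial>expo_prod I \<rho>)"
    by (rule nn_integral_cong_AE[OF AE])
  also have "\<dots> = (\<Sum>q\<in>Q. \<integral>\<^sup>+x. ?W q x * F x \<partial>expo_prod I \<rho>)"
    by (rule nn_integral_sum) measurable
  also have "\<dots> = (\<Sum>q\<in>Q. ennreal (\<rho> q / ?L) *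
           (\<integral>\<^sup>+y. F (race_map Q q y) \<partial>expo_prod I (\<rho>(q := ?L))))"
  proof (rule sum.cong[OF refl])
    fix q assume q: "q \<in> Q"
    then have qI: "q \<in> I" and Iq: "insert q (I - {q}) = I" using I by auto
    define G where "G y = (\<integral>\<^sup>+x. F (race_map Q q (x(q := y))) \<partial>expo_prod (I - {q}) \<rho>)" for y
    have m: "(\<lambda>x. F (race_map Q q x)) \<in> borel_measurable (Pi\<^sub>M I (\<lambda>_. borel))"
      using measurable_compose[OF measurable_race_map[OF I(2) q] F] .
    have G [measurable]: "G \<in> borel_measurable borel"
    proof -
      have h: "(\<lambda>(y, x). x(q := y)) \<in> (borel \<Otimes>\<^sub>M Pi\<^sub>M (I - {q}) (\<lambda>_. borel)) \<rightarrow>\<^sub>M Pi\<^sub>M (insert q (I - {q})) (\<lambda>_. borel)"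
        by measurable
      then have "(\<lambda>(y, x). F (race_map Q q (x(q := y)))) \<in> borel_measurable (borel \<Otimes>\<^sub>M Pi\<^sub>M (I - {q}) (\<lambda>_. borel))"
        using measurable_compose[OF h[unfolded Iq] m] by (simp add: case_prod_unfold)
      then have "(\<lambda>(y, x). F (race_map Q q (x(q := y)))) \<in> borel_measurable (borel \<Otimes>\<^sub>M expo_prod (I - {q}) \<rho>)"
        by (simp cong: measurable_cong_sets sets_pair_measure_cong)
      then show ?thesis unfolding G_def
        by (rule sigma_finite_measure.borel_measurable_nn_integral[OF prob_space_imp_sigma_finite[OF prob_space_expo_prod]])
    qed
    \<comment> \<open>The density of \<open>q\<close> at \<open>y\<close>, times the probability
      that all its rivals exceed \<open>y\<close>, equals the chance that \<open>q\<close> wins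
      times the density of the minimum at \<open>y\<close>.\<close>
    have e: "ennreal (exponential_density (\<rho> q) y) * ennreal (exp (- (\<Sum>i\<in>Q - {q}. \<rho> i) * y)) =
        ennreal (\<rho> q / ?L) * ennreal (exponential_density ?L y)" for y
    proof -
      have "?L = \<rho> q + (\<Sum>i\<in>Q - {q}. \<rho> i)" using fQ q by (simp add: sum.remove)
      then have "exp (- y * \<rho> q) * exp (- (\<Sum>i\<in>Q - {q}. \<rho> i) * y) = exp (- y * ?L)"
        by (simp only: exp_add[symmetric]) (simp add: algebra_simps)
      then have "exponential_density (\<rho> q) y * exp (- (\<Sum>i\<in>Q - {q}. \<rho> i) * y) =
         \<rho> q / ?L * exponential_density ?L y"
        using L by (simp add: exponential_density_def)
      then show ?thesis using L l[OF q]
        by (simp add: ennreal_mult'[symmetric] ennreal_mult''[symmetric] exponential_density_nonneg)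
    qed
    \<comment> \<open>Integrating over coordinate \<open>q\<close> last makes the winner's time a
      constant \<open>y\<close> for the inner integral, as the shift lemma requires.\<close>
    have "(\<integral>\<^sup>+x. ?W q x * F x \<partial>expo_prod I \<rho>) =
      (\<integral>\<^sup>+y. (\<integral>\<^sup>+x. ?W q (x(q := y)) * F (x(q := y)) \<partial>expo_prod (I - {q}) \<rho>) \<partial>expo (\<rho> q))"
      by (rule nn_integral_expo_prod_insert_rev) (use I qI q in measurable)
    also have "\<dots> = (\<integral>\<^sup>+y. ennreal (exp (- (\<Sum>i\<in>Q - {q}. \<rho> i) * y)) * G y \<partial>expo (\<rho> q))"
    proof (rule nn_integral_cong_AE, use AE_expo_nonneg in eventually_elim)
      fix y :: real assume y: "0 \<le> y"
      have Fy: "(\<lambda>x. F (x(q := y))) \<in> borel_measurable (Pi\<^sub>M (I - {q}) (\<lambda>_. borel))"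
      proof -
        have "(\<lambda>x. x(q := y)) \<in> Pi\<^sub>M (I - {q}) (\<lambda>_. borel) \<rightarrow>\<^sub>M Pi\<^sub>M (insert q (I - {q})) (\<lambda>_. borel)"
          by measurable
        then show ?thesis using F unfolding Iq by (rule measurable_compose)
      qed
      have "(\<integral>\<^sup>+x. ?W q (x(q := y)) * F (x(q := y)) \<partial>expo_prod (I - {q}) \<rho>) =
        (\<integral>\<^sup>+x. indicator {x. \<forall>i\<in>Q - {q}. y < x i} x * F (x(q := y)) \<partial>expo_prod (I - {q}) \<rho>)"
        by (intro nn_integral_cong) (auto simp: indicator_def)
      also have "\<dots> = ennreal (exp (- (\<Sum>i\<in>Q - {q}. \<rho> i) * y)) *
         (\<integral>\<^sup>+x. F ((\<lambda>i. if i \<in> Q - {q} then y + x i else x i)(q := y)) \<partial>expo_prod (I - {q}) \<rho>)"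
        by (rule nn_integral_expo_prod_shift) (use I l y Fy in auto)
      also have "\<dots> = ennreal (exp (- (\<Sum>i\<in>Q - {q}. \<rho> i) * y)) * G y"
      proof -
        have "(\<lambda>i. if i \<in> Q - {q} then y + x i else x i)(q := y) = race_map Q q (x(q := y))" for x
          by (auto simp: race_map_def fun_eq_iff)
        then show ?thesis by (simp only: G_def)
      qed
      finally show "(\<integral>\<^sup>+x. ?W q (x(q := y)) * F (x(q := y)) \<partial>expo_prod (I - {q}) \<rho>) =
         ennreal (exp (- (\<Sum>i\<in>Q - {q}. \<rho> i) * y)) * G y" .
    qed
    also have "\<dots> = (\<integral>\<^sup>+y. ennreal (exponential_density (\<rho> q) y) *
        (ennreal (exp (- (\<Sum>i\<in>Q - {q}. \<rho> i) * y)) * G y) \<partial>lborel)"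
      by (rule nn_integral_expo) (use l q in auto)
    also have "\<dots> = (\<integral>\<^sup>+y. ennreal (\<rho> q / ?L) * (ennreal (exponential_density ?L y) * G y) \<partial>lborel)"
      by (simp only: mult.assoc[symmetric] e)
    also have "\<dots> = ennreal (\<rho> q / ?L) * (\<integral>\<^sup>+y. G y \<partial>expo ?L)"
      by (simp add: nn_integral_cmult nn_integral_expo[OF L])
    also have "(\<integral>\<^sup>+y. G y \<partial>expo ?L) = (\<integral>\<^sup>+y. F (race_map Q q y) \<partial>expo_prod I (\<rho>(q := ?L)))"
      unfolding nn_integral_expo_prod_insert_rev[OF I(1) qI m] G_def
      by (simp add: expo_prod_fun_upd del: fun_upd_apply) simp
    finally show "(\<integral>\<^sup>+x. ?W q x * F x \<partial>expo_prod I \<rho>) = ennreal (\<rho> q / ?L) *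
           (\<integral>\<^sup>+y. F (race_map Q q y) \<partial>expo_prod I (\<rho>(q := ?L)))" .
  qed
  finally show ?thesis .
qed

section \<open>Minima of linear forms\<close>

lemma nn_integral_expo_scale:
  assumes l: "0 < l" and s: "0 < s" and [measurable]: "f \<in> borel_measurable borel"
  shows "(\<integral>\<^sup>+x. f x \<partial>expo l) = (\<integral>\<^sup>+x. f (x / s) \<partial>expo (l / s))"
proof -
  have "(\<integral>\<^sup>+x. f x \<partial>expo l) = (\<integral>\<^sup>+x. ennreal (exponential_density l x) * f x \<partial>lborel)"
    by (rule nn_integral_expo) (use l in auto)
  also have "\<dots> = ennreal (1 / s) * (\<integral>\<^sup>+x. ennreal (exponential_density l (x / s)) * f (x / s) \<partial>lborel)"
    using nn_integral_real_affine[of "\<lambda>x. ennreal (exponential_density l x) * f x" "1 / s" 0] s by simp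
  also have "\<dots> = (\<integral>\<^sup>+x. ennreal (1 / s) * (ennreal (exponential_density l (x / s)) * f (x / s)) \<partial>lborel)"
    by (rule nn_integral_cmult[symmetric]) measurable
  also have "\<dots> = (\<integral>\<^sup>+x. ennreal (exponential_density (l / s) x) * f (x / s) \<partial>lborel)"
  proof (rule nn_integral_cong)
    fix x
    have "1 / s * exponential_density l (x / s) = exponential_density (l / s) x"
      using s by (auto simp: exponential_density_def field_simps)
    then show "ennreal (1 / s) * (ennreal (exponential_density l (x / s)) * f (x / s)) =
       ennreal (exponential_density (l / s) x) * f (x / s)"
      using s by (simp only: mult.assoc[symmetric] ennreal_mult'[symmetric] zero_le_divide_1_iff less_imp_le)
  qed
  also have "\<dots> = (\<integral>\<^sup>+x. f (x / s) \<partial>expo (l / s))"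
    by (rule nn_integral_expo[symmetric]) (use l s in auto)
  finally show ?thesis .
qed

lemma nn_integral_expo_prod_scale:
  assumes I: "finite I" "a \<in> I" and l: "0 < \<rho> a" and s: "0 < s"
    and F: "F \<in> borel_measurable (Pi\<^sub>M I (\<lambda>_. borel))"
  shows "(\<integral>\<^sup>+x. F x \<partial>expo_prod I \<rho>) = (\<integral>\<^sup>+y. F (y(a := y a / s)) \<partial>expo_prod I (\<rho>(a := \<rho> a / s)))"
proof -
  have Ia: "insert a (I - {a}) = I" using I by auto
  have [measurable]: "(\<lambda>x. x a) \<in> borel_measurable (Pi\<^sub>M I (\<lambda>_. borel))"
    using I by (auto intro: measurable_component_singleton)
  have upd: "(\<lambda>y. y(a := y a / s)) \<in> Pi\<^sub>M I (\<lambda>_. borel) \<rightarrow>\<^sub>M Pi\<^sub>M I (\<lambda>_. borel)"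
    using I by (intro measurable_single_shift) auto
  have m: "(\<lambda>y. F (x(a := y))) \<in> borel_measurable borel" if "x \<in> space (expo_prod (I - {a}) \<rho>)" for x
  proof -
    have "(\<lambda>y. x(a := y)) \<in> borel \<rightarrow>\<^sub>M Pi\<^sub>M (insert a (I - {a})) (\<lambda>_. borel)"
      using that by (intro measurable_PiM_single') (auto simp: space_expo_prod PiE_def extensional_def)
    then show ?thesis using F unfolding Ia by (rule measurable_compose)
  qed
  have "(\<integral>\<^sup>+x. F x \<partial>expo_prod I \<rho>) =
      (\<integral>\<^sup>+x. (\<integral>\<^sup>+y. F (x(a := y)) \<partial>expo (\<rho> a)) \<partial>expo_prod (I - {a}) \<rho>)"
    by (rule nn_integral_expo_prod_insert[OF I F])
  also have "\<dots> = (\<integral>\<^sup>+x. (\<integral>\<^sup>+y. F (x(a := y / s)) \<partial>expo (\<rho> a / s)) \<partial>expo_prod (I - {a}) \<rho>)"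
    by (intro nn_integral_cong nn_integral_expo_scale l s m)
  also have "\<dots> = (\<integral>\<^sup>+y. F (y(a := y a / s)) \<partial>expo_prod I (\<rho>(a := \<rho> a / s)))"
    using nn_integral_expo_prod_insert[OF I measurable_compose[OF upd F], of "\<rho>(a := \<rho> a / s)"]
    by (simp add: expo_prod_fun_upd)
  finally show ?thesis .
qed

lemma nn_integral_expo_prod_component:
  assumes "finite I" "a \<in> I" "0 < \<rho> a"
  shows "(\<integral>\<^sup>+x. ennreal (x a) \<partial>expo_prod I \<rho>) = ennreal (1 / \<rho> a)"
proof -
  have [measurable]: "(\<lambda>x. x a) \<in> borel_measurable (Pi\<^sub>M I (\<lambda>_. borel))"
    using assms by (auto intro: measurable_component_singleton)
  have "(\<integral>\<^sup>+x. ennreal (x a) \<partial>expo_prod I \<rho>) =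
      (\<integral>\<^sup>+x. (\<integral>\<^sup>+y. ennreal y \<partial>expo (\<rho> a)) \<partial>expo_prod (I - {a}) \<rho>)"
    using nn_integral_expo_prod_insert[OF assms(1,2), of "\<lambda>x. ennreal (x a)" \<rho>] by simp
  also have "(\<integral>\<^sup>+y. ennreal y \<partial>expo (\<rho> a)) =
      (\<integral>\<^sup>+y. ennreal (exponential_density (\<rho> a) y) * ennreal y \<partial>lborel)"
    by (rule nn_integral_expo) (use assms in auto)
  also have "\<dots> = (\<integral>\<^sup>+y. ennreal (exponential_density (\<rho> a) y * y ^ 1) \<partial>lborel)"
    by (intro nn_integral_cong) (use assms in \<open>simp add: ennreal_mult' exponential_density_nonneg\<close>)
  also have "\<dots> = ennreal (1 / \<rho> a)"
    by (subst nn_integral_erlang_ith_moment) (use assms in simp_all)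
  also have "(\<integral>\<^sup>+x. ennreal (1 / \<rho> a) \<partial>expo_prod (I - {a}) \<rho>) = ennreal (1 / \<rho> a)"
    by (simp add: prob_space.emeasure_space_1[OF prob_space_expo_prod])
  finally show ?thesis .
qed

section \<open>Rational functions without poles on a ray\<close>

definition rational_from :: "real \<Rightarrow> (real \<Rightarrow> real) \<Rightarrow> bool" where
  "rational_from K f \<longleftrightarrow> (\<exists>p q. \<forall>x\<ge>K. 0 < poly q x \<and> f x = poly p x / poly q x)"

lemma rational_from_poly: "rational_from K (poly p)"
  unfolding rational_from_def by (rule exI[of _ p], rule exI[of _ 1]) simp

lemma rational_from_const: "rational_from K (\<lambda>_. c)"
  unfolding rational_from_def by (intro exI[of _ "[:c:]"] exI[of _ 1]) simp

lemma rational_from_ident_diff: "rational_from K (\<lambda>x. x - c)"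
  unfolding rational_from_def by (intro exI[of _ "[:-c, 1:]"] exI[of _ 1]) simp

lemma rational_from_add:
  assumes "rational_from K f" "rational_from K g"
  shows "rational_from K (\<lambda>x. f x + g x)"
proof -
  obtain p q p' q' where "\<And>x. x \<ge> K \<Longrightarrow> 0 < poly q x \<and> f x = poly p x / poly q x"
    and "\<And>x. x \<ge> K \<Longrightarrow> 0 < poly q' x \<and> g x = poly p' x / poly q' x"
    using assms unfolding rational_from_def by blast
  then have "0 < poly (q * q') x \<and> f x + g x = poly (p * q' + p' * q) x / poly (q * q') x" if "x \<ge> K" for x
    using that by (simp add: add_frac_eq less_imp_neq[symmetric])
  then show ?thesis unfolding rational_from_def by blast
qed

lemma rational_from_mult:
  assumes "rational_from K f" "rational_from K g"
  shows "rational_from K (\<lambda>x. f x * g x)"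
proof -
  obtain p q p' q' where "\<And>x. x \<ge> K \<Longrightarrow> 0 < poly q x \<and> f x = poly p x / poly q x"
    and "\<And>x. x \<ge> K \<Longrightarrow> 0 < poly q' x \<and> g x = poly p' x / poly q' x"
    using assms unfolding rational_from_def by blast
  then show ?thesis unfolding rational_from_def
    by (intro exI[of _ "p * p'"] exI[of _ "q * q'"]) simp
qed

text \<open>The denominator of \<open>g\<close> is positive on the ray, so positivity of
  \<open>g\<close> passes to its numerator, which becomes part of the new denominator. In the
  applications \<open>g\<close> is a rate, a sum of two rates, \<open>x - real j\<close> or a
  positive constant.\<close>

lemma rational_from_divide:
  assumes "rational_from K f" "rational_from K g" "\<And>x. x \<ge> K \<Longrightarrow> 0 < g x"
  shows "rational_from K (\<lambda>x. f x / g x)"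
proof -
  obtain p q p' q' where 1: "\<And>x. x \<ge> K \<Longrightarrow> 0 < poly q x \<and> f x = poly p x / poly q x"
    and 2: "\<And>x. x \<ge> K \<Longrightarrow> 0 < poly q' x \<and> g x = poly p' x / poly q' x"
    using assms unfolding rational_from_def by blast
  have "0 < poly p' x" if "x \<ge> K" for x
    using 2[OF that] assms(3)[OF that] by (simp add: zero_less_divide_iff)
  with 1 2 show ?thesis unfolding rational_from_def
    by (intro exI[of _ "p * q'"] exI[of _ "q * p'"]) simp
qed

lemma rational_from_sum:
  "(\<And>i. i \<in> A \<Longrightarrow> rational_from K (f i)) \<Longrightarrow> rational_from K (\<lambda>x. \<Sum>i\<in>A. f i x)"
  by (induction A rule: infinite_finite_induct)
    (auto intro: rational_from_add rational_from_const)

lemma Min_image_remove: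
  fixes g :: "'a \<Rightarrow> 'b :: linorder"
  assumes "finite S" "a \<in> S" "b \<in> S" "a \<noteq> b" "g b \<le> g a"
  shows "Min (g ` S) = Min (g ` (S - {a}))"
proof -
  have "Min (g ` (S - {a})) \<le> g b" using assms by (intro Min_le) auto
  then have "Min (g ` (S - {a})) \<le> g a" using assms(5) by simp
  moreover have "Min (insert (g a) (g ` (S - {a}))) = min (g a) (Min (g ` (S - {a})))"
    using assms by (intro Min_insert) auto
  moreover have "insert (g a) (g ` (S - {a})) = g ` S" using assms(2) by auto
  ultimately show ?thesis by (simp add: min.absorb2)
qed

text \<open>If \<open>a\<close> wins, both original times contain \<open>y a\<close>, so the winner
  collects the coefficients of both racers and the loser keeps its own.\<close>

lemma form_race_map:
  fixes c y :: "'v \<Rightarrow> real"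
  assumes "finite V" "a \<in> V" "b \<in> V" "a \<noteq> b"
  shows "(\<Sum>v\<in>V. c v * race_map {a, b} a y v) = (\<Sum>v\<in>V. (c(a := c a + c b)) v * y v)"
proof -
  have "(\<Sum>v\<in>V. c v * race_map {a, b} a y v) = (\<Sum>v\<in>V. c v * y v + (if v = b then c b * y a else 0))"
    using assms(4) by (intro sum.cong) (auto simp: race_map_def algebra_simps)
  also have "\<dots> = (\<Sum>v\<in>V. c v * y v + (if v = a then c b * y a else 0))"
    using assms by (simp add: sum.distrib)
  also have "\<dots> = (\<Sum>v\<in>V. (c(a := c a + c b)) v * y v)"
    by (intro sum.cong) (auto simp: algebra_simps)
  finally show ?thesis .
qed

lemma form_scale:
  fixes c y :: "'v \<Rightarrow> real"
  shows "(\<Sum>v\<in>V. c v * (y(a := y a / s)) v) = (\<Sum>v\<in>V. (c(a := c a / s)) v * y v)"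
  by (intro sum.cong) auto

definition min_form :: "'v set \<Rightarrow> 's set \<Rightarrow> ('s \<Rightarrow> 'v \<Rightarrow> real) \<Rightarrow> ('v \<Rightarrow> real) \<Rightarrow> real" where
  "min_form V S c y = Min ((\<lambda>s. \<Sum>v\<in>V. c s v * y v) ` S)"

lemma measurable_min_form:
  assumes "finite S" "V \<subseteq> I"
  shows "(\<lambda>y. ennreal (min_form V S c y)) \<in> borel_measurable (Pi\<^sub>M I (\<lambda>_. borel))"
proof -
  have [measurable]: "(\<lambda>x. x i) \<in> borel_measurable (Pi\<^sub>M I (\<lambda>_. borel))" if "i \<in> V" for i
    using that assms by (auto intro: measurable_component_singleton)
  show ?thesis unfolding min_form_def using assms by measurable
qed

text \<open>The parameter \<open>x\<close> is real so that denominators are controlled between the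
  integers too. The bound \<open>0 \<le> f x\<close> matters because \<open>ennreal\<close> sends
  negative reals to 0, so that the equation alone would not determine \<open>f x\<close> where the
  mean is 0.\<close>

definition rational_mean :: "real \<Rightarrow> 'v set \<Rightarrow> 's set \<Rightarrow> ('v \<Rightarrow> real \<Rightarrow> real) \<Rightarrow> ('s \<Rightarrow> 'v \<Rightarrow> real) \<Rightarrow> bool" where
  "rational_mean K V S \<rho> c \<longleftrightarrow> (\<exists>f. rational_from K f \<and> (\<forall>x\<ge>K. 0 \<le> f x \<and>
     (\<integral>\<^sup>+y. ennreal (min_form V S c y) \<partial>expo_prod V (\<lambda>v. \<rho> v x)) = ennreal (f x)))"

lemma rational_mean_remove:
  assumes "finite V" "finite S" "a \<in> S" "b \<in> S" "a \<noteq> b" "\<And>v. v \<in> V \<Longrightarrow> c b v \<le> c a v"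
    and "rational_mean K V (S - {a}) \<rho> c"
  shows "rational_mean K V S \<rho> c"
proof -
  have "(\<integral>\<^sup>+y. ennreal (min_form V S c y) \<partial>expo_prod V (\<lambda>v. \<rho> v x)) =
    (\<integral>\<^sup>+y. ennreal (min_form V (S - {a}) c y) \<partial>expo_prod V (\<lambda>v. \<rho> v x))" for x
  proof (rule nn_integral_cong_AE, use AE_expo_prod_nonneg[OF assms(1)] in eventually_elim)
    case (elim y)
    then have "(\<Sum>v\<in>V. c b v * y v) \<le> (\<Sum>v\<in>V. c a v * y v)"
      using assms by (intro sum_mono mult_right_mono) auto
    then show ?case unfolding min_form_def using assms by (subst Min_image_remove[of S a b]) auto
  qed
  with assms(7) show ?thesis unfolding rational_mean_def by simp
qed

lemma rational_mean_scale:
  assumes "finite V" "finite S" "a \<in> V" "0 < s" "\<And>x. x \<ge> K \<Longrightarrow> 0 < \<rho> a x"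
    and "rational_mean K V S (\<rho>(a := \<lambda>x. \<rho> a x / s)) (\<lambda>t. (c t)(a := c t a / s))"
  shows "rational_mean K V S \<rho> c"
proof -
  have "(\<integral>\<^sup>+y. ennreal (min_form V S c y) \<partial>expo_prod V (\<lambda>v. \<rho> v x)) =
    (\<integral>\<^sup>+y. ennreal (min_form V S (\<lambda>t. (c t)(a := c t a / s)) y)
      \<partial>expo_prod V (\<lambda>v. (\<rho>(a := \<lambda>x. \<rho> a x / s)) v x))" if "x \<ge> K" for x
  proof -
    have "min_form V S c (y(a := y a / s)) = min_form V S (\<lambda>t. (c t)(a := c t a / s)) y" for y
      unfolding min_form_def form_scale ..
    moreover have "(\<lambda>v. \<rho> v x)(a := \<rho> a x / s) = (\<lambda>v. (\<rho>(a := \<lambda>x. \<rho> a x / s)) v x)"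
      by auto
    ultimately show ?thesis
      using nn_integral_expo_prod_scale[of V a "\<lambda>v. \<rho> v x" s "\<lambda>y. ennreal (min_form V S c y)",
        OF assms(1,3) assms(5)[OF that] assms(4) measurable_min_form[OF assms(2) order_refl]]
      by (simp only:)
  qed
  with assms(6) show ?thesis unfolding rational_mean_def by simp
qed

lemma rational_mean_race:
  assumes V: "finite V" and S: "finite S" and a: "a \<in> V" and b: "b \<in> V" and ab: "a \<noteq> b"
    and pos: "\<And>v x. v \<in> V \<Longrightarrow> x \<ge> K \<Longrightarrow> 0 < \<rho> v x"
    and rat: "\<And>v. v \<in> V \<Longrightarrow> rational_from K (\<rho> v)"
    and A: "rational_mean K V S (\<rho>(a := \<lambda>x. \<rho> a x + \<rho> b x)) (\<lambda>t. (c t)(a := c t a + c t b))"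
    and B: "rational_mean K V S (\<rho>(b := \<lambda>x. \<rho> a x + \<rho> b x)) (\<lambda>t. (c t)(b := c t a + c t b))"
  shows "rational_mean K V S \<rho> c"
proof -
  obtain f where f: "rational_from K f" "\<And>x. x \<ge> K \<Longrightarrow> 0 \<le> f x \<and>
     (\<integral>\<^sup>+y. ennreal (min_form V S (\<lambda>t. (c t)(a := c t a + c t b)) y)
       \<partial>expo_prod V (\<lambda>v. (\<rho>(a := \<lambda>x. \<rho> a x + \<rho> b x)) v x)) = ennreal (f x)"
    using A unfolding rational_mean_def by blast
  obtain g where g: "rational_from K g" "\<And>x. x \<ge> K \<Longrightarrow> 0 \<le> g x \<and>
     (\<integral>\<^sup>+y. ennreal (min_form V S (\<lambda>t. (c t)(b := c t a + c t b)) y)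
       \<partial>expo_prod V (\<lambda>v. (\<rho>(b := \<lambda>x. \<rho> a x + \<rho> b x)) v x)) = ennreal (g x)"
    using B unfolding rational_mean_def by blast
  define h where "h x = \<rho> a x / (\<rho> a x + \<rho> b x) * f x + \<rho> b x / (\<rho> a x + \<rho> b x) * g x" for x
  have "rational_from K h"
    unfolding h_def using f g pos a b rat
    by (intro rational_from_add rational_from_mult rational_from_divide add_pos_pos) auto
  moreover have "0 \<le> h x \<and>
     (\<integral>\<^sup>+y. ennreal (min_form V S c y) \<partial>expo_prod V (\<lambda>v. \<rho> v x)) = ennreal (h x)" if x: "x \<ge> K" for x
  proof -
    have r: "0 \<le> \<rho> a x / (\<rho> a x + \<rho> b x)" "0 \<le> \<rho> b x / (\<rho> a x + \<rho> b x)"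
      using pos[OF a x] pos[OF b x] by auto
    have Q: "{a, b} \<subseteq> V" "{a, b} \<noteq> {}" using a b by auto
    have "min_form V S c (race_map {a, b} a y) = min_form V S (\<lambda>t. (c t)(a := c t a + c t b)) y" for y
      unfolding min_form_def form_race_map[OF V a b ab] ..
    moreover have "min_form V S c (race_map {a, b} b y) = min_form V S (\<lambda>t. (c t)(b := c t a + c t b)) y" for y
      unfolding min_form_def insert_commute[of a b] form_race_map[OF V b a ab[symmetric]]
      by (simp add: add.commute)
    moreover have "(\<lambda>v. \<rho> v x)(a := \<rho> a x + \<rho> b x) = (\<lambda>v. (\<rho>(a := \<lambda>x. \<rho> a x + \<rho> b x)) v x)"
      "(\<lambda>v. \<rho> v x)(b := \<rho> a x + \<rho> b x) = (\<lambda>v. (\<rho>(b := \<lambda>x. \<rho> a x + \<rho> b x)) v x)"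
      by auto
    ultimately have "(\<integral>\<^sup>+y. ennreal (min_form V S c y) \<partial>expo_prod V (\<lambda>v. \<rho> v x)) =
      ennreal (\<rho> a x / (\<rho> a x + \<rho> b x)) * ennreal (f x) + ennreal (\<rho> b x / (\<rho> a x + \<rho> b x)) * ennreal (g x)"
      using nn_integral_expo_prod_race[OF V Q _ measurable_min_form[OF S order_refl], of "\<lambda>v. \<rho> v x" c]
        f(2)[OF x] g(2)[OF x] pos[OF a x] pos[OF b x] ab by auto
    also have "\<dots> = ennreal (h x)"
      unfolding h_def using r f(2)[OF x] g(2)[OF x]
      by (subst ennreal_plus) (auto simp only: ennreal_mult intro!: mult_nonneg_nonneg)
    finally have "(\<integral>\<^sup>+y. ennreal (min_form V S c y) \<partial>expo_prod V (\<lambda>v. \<rho> v x)) = ennreal (h x)" .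
    moreover have "0 \<le> h x"
      unfolding h_def using r f(2)[OF x] g(2)[OF x] by (intro add_nonneg_nonneg mult_nonneg_nonneg) auto
    ultimately show ?thesis by simp
  qed
  ultimately show ?thesis unfolding rational_mean_def by blast
qed

lemma rational_mean_single:
  assumes V: "finite V"
    and pos: "\<And>v x. v \<in> V \<Longrightarrow> x \<ge> K \<Longrightarrow> 0 < \<rho> v x"
    and rat: "\<And>v. v \<in> V \<Longrightarrow> rational_from K (\<rho> v)"
    and c: "\<And>v. v \<in> V \<Longrightarrow> 0 \<le> c s v"
  shows "rational_mean K V {s} \<rho> c"
proof -
  have m: "(\<lambda>y. y v) \<in> borel_measurable (Pi\<^sub>M V (\<lambda>_. borel))" if "v \<in> V" for v
    using that by (auto intro: measurable_component_singleton)
  have "(\<integral>\<^sup>+y. ennreal (min_form V {s} c y) \<partial>expo_prod V (\<lambda>v. \<rho> v x)) = ennreal (\<Sum>v\<in>V. c s v * (1 / \<rho> v x))"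
    if x: "x \<ge> K" for x
  proof -
    have "(\<integral>\<^sup>+y. ennreal (min_form V {s} c y) \<partial>expo_prod V (\<lambda>v. \<rho> v x)) =
      (\<integral>\<^sup>+y. (\<Sum>v\<in>V. ennreal (c s v) * ennreal (y v)) \<partial>expo_prod V (\<lambda>v. \<rho> v x))"
    proof (rule nn_integral_cong_AE, use AE_expo_prod_nonneg[OF assms(1)] in eventually_elim)
      case (elim y)
      then show ?case using c
        by (simp add: min_form_def ennreal_mult[symmetric] sum_ennreal)
    qed
    also have "\<dots> = (\<Sum>v\<in>V. ennreal (c s v) * (\<integral>\<^sup>+y. ennreal (y v) \<partial>expo_prod V (\<lambda>v. \<rho> v x)))"
      using m by (subst nn_integral_sum) (auto intro!: sum.cong nn_integral_cmult)
    also have "\<dots> = (\<Sum>v\<in>V. ennreal (c s v) * ennreal (1 / \<rho> v x))"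
      by (intro sum.cong refl arg_cong2[of _ _ _ _ "(*)"] nn_integral_expo_prod_component V pos x)
    also have "\<dots> = ennreal (\<Sum>v\<in>V. c s v * (1 / \<rho> v x))"
      using c pos x by (subst sum_ennreal[symmetric]) (auto simp: ennreal_mult'[symmetric] less_imp_le)
    finally show ?thesis .
  qed
  moreover have "rational_from K (\<lambda>x. \<Sum>v\<in>V. c s v * (1 / \<rho> v x))"
    by (intro rational_from_sum rational_from_mult rational_from_divide rational_from_const rat pos)
  moreover have "0 \<le> (\<Sum>v\<in>V. c s v * (1 / \<rho> v x))" if "x \<ge> K" for x
    using c pos that by (intro sum_nonneg mult_nonneg_nonneg) (auto simp: less_imp_le)
  ultimately show ?thesis unfolding rational_mean_def by blast
qed

text \<open>
  To compare two forms, pick variables \<open>a\<close> and \<open>b\<close> at which their difference has coefficients of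
  opposite signs, scale these coefficients to 1 and -1, and let the variables race: the difference
  then loses a coefficient. When its coefficients have one sign, one of the forms can be dropped.
\<close>
lemma rational_mean_min_form:
  fixes c :: "'s \<Rightarrow> 'v \<Rightarrow> real"
  assumes "finite S" "S \<noteq> {}" "finite V"
    and "\<And>v x. v \<in> V \<Longrightarrow> x \<ge> K \<Longrightarrow> 0 < \<rho> v x"
    and "\<And>v. v \<in> V \<Longrightarrow> rational_from K (\<rho> v)"
    and "\<And>s v. s \<in> S \<Longrightarrow> v \<in> V \<Longrightarrow> 0 \<le> c s v"
  shows "rational_mean K V S \<rho> c"
  using assms
proof (induction S arbitrary: \<rho> c rule: finite_psubset_induct)
  case (psubset S)
  note outer = psubset.IH
  have S: "finite S" and V: "finite V" by fact+
  obtain s where s: "s \<in> S" using psubset.prems by auto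
  show ?case
  proof (cases "S = {s}")
    case True
    show ?thesis unfolding True
      by (rule rational_mean_single) (use psubset.prems True in auto)
  next
    case False
    then obtain t where t: "t \<in> S" "t \<noteq> s" using s by auto
    show ?thesis using psubset.prems(3-)
    \<comment> \<open>The two forms \<open>s\<close> and \<open>t\<close> stay fixed while rates and
      coefficients change; the number of variables at which they disagree decreases until one
      dominates the other.\<close>
    proof (induction "card {v \<in> V. c s v \<noteq> c t v}" arbitrary: \<rho> c rule: less_induct)
      case (less c \<rho>)
      note pos = less.prems(1) and rat = less.prems(2) and c = less.prems(3)
      consider "\<And>v. v \<in> V \<Longrightarrow> c t v \<le> c s v" | "\<And>v. v \<in> V \<Longrightarrow> c s v \<le> c t v"
        | a b where "a \<in> V" "b \<in> V" "c s a > c t a" "c s b < c t b"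
        by (meson not_le)
      then show ?case
      proof cases
        case 1
        have "rational_mean K V (S - {s}) \<rho> c"
          by (rule outer) (use s t V pos rat c in auto)
        with 1 show ?thesis by (rule rational_mean_remove[OF V S s t(1) t(2)[symmetric]])
      next
        case 2
        have "rational_mean K V (S - {t}) \<rho> c"
          by (rule outer) (use s t V pos rat c in auto)
        with 2 show ?thesis by (rule rational_mean_remove[OF V S t(1) s t(2)])
      next
        case 3
        then have ab: "a \<noteq> b" by auto
        \<comment> \<open>Dividing by these makes the difference of the forms \<open>s\<close> and
          \<open>t\<close> exactly 1 at \<open>a\<close> and -1 at \<open>b\<close>.\<close>
        define \<alpha> \<beta> where "\<alpha> = c s a - c t a" and "\<beta> = c t b - c s b"
        have \<alpha>\<beta>: "0 < \<alpha>" "0 < \<beta>" using 3 by (auto simp: \<alpha>_def \<beta>_def)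
        define \<sigma> where "\<sigma> = \<rho>(a := \<lambda>x. \<rho> a x / \<alpha>, b := \<lambda>x. \<rho> b x / \<beta>)"
        define d where "d u = (c u)(a := c u a / \<alpha>, b := c u b / \<beta>)" for u
        have \<sigma>: "0 < \<sigma> v x" if "v \<in> V" "x \<ge> K" for v x
          using pos that \<alpha>\<beta> by (auto simp: \<sigma>_def)
        have \<sigma>rat: "rational_from K (\<sigma> v)" if "v \<in> V" for v
          using rat[OF that] \<alpha>\<beta> by (auto simp: \<sigma>_def intro!: rational_from_divide rational_from_const)
        have d: "0 \<le> d u v" if "u \<in> S" "v \<in> V" for u v
          using c that \<alpha>\<beta> 3 by (auto simp: d_def)
        \<comment> \<open>The winner receives the sum of its own and its rival's coefficient, on
          which \<open>s\<close> and \<open>t\<close> now agree. At every other variable they agree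
          or disagree as before, since scaling treats both alike; so one disagreement
          disappears.\<close>
        have eq: "d s a + d s b = d t a + d t b"
          using \<alpha>\<beta> ab unfolding d_def by (simp add: \<alpha>_def \<beta>_def field_simps)
        have step: "rational_mean K V S (\<sigma>(q := \<lambda>x. \<sigma> a x + \<sigma> b x)) (\<lambda>u. (d u)(q := d u a + d u b))"
          if q: "q = a \<or> q = b" for q
        proof (rule less.hyps)
          have "v \<noteq> q \<and> c s v \<noteq> c t v"
            if v: "((d s)(q := d s a + d s b)) v \<noteq> ((d t)(q := d t a + d t b)) v" for v
          proof -
            have vq: "v \<noteq> q" using v eq by auto
            then have "d s v \<noteq> d t v" using v by simp
            then have "c s v \<noteq> c t v" by (auto simp: d_def split: if_splits)
            with vq show ?thesis by simp
          qed
          moreover have "q \<in> V" "c s q \<noteq> c t q" using q 3 by auto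
          ultimately have "{v \<in> V. ((d s)(q := d s a + d s b)) v \<noteq> ((d t)(q := d t a + d t b)) v} \<subset> {v \<in> V. c s v \<noteq> c t v}"
            by blast
          then show "card {v \<in> V. ((d s)(q := d s a + d s b)) v \<noteq> ((d t)(q := d t a + d t b)) v} < card {v \<in> V. c s v \<noteq> c t v}"
            using V by (intro psubset_card_mono) auto
        qed (use \<sigma> \<sigma>rat d 3 in \<open>auto intro!: rational_from_add add_pos_pos\<close>)
        have \<sigma>d: "rational_mean K V S \<sigma> d"
          by (rule rational_mean_race[OF V S 3(1,2) ab \<sigma> \<sigma>rat]) (use step in auto)
        have \<sigma>_eq: "(\<rho>(a := \<lambda>x. \<rho> a x / \<alpha>))(b := \<lambda>x. (\<rho>(a := \<lambda>x. \<rho> a x / \<alpha>)) b x / \<beta>) = \<sigma>"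
          using ab by (simp add: \<sigma>_def)
        have d_eq: "(\<lambda>u. ((c u)(a := c u a / \<alpha>))(b := ((c u)(a := c u a / \<alpha>)) b / \<beta>)) = d"
          using ab by (simp add: d_def fun_eq_iff)
        have "0 < (\<rho>(a := \<lambda>x. \<rho> a x / \<alpha>)) b x" if "x \<ge> K" for x
          using pos[OF 3(2) that] ab by simp
        then have "rational_mean K V S (\<rho>(a := \<lambda>x. \<rho> a x / \<alpha>)) (\<lambda>u. (c u)(a := c u a / \<alpha>))"
          by (rule rational_mean_scale[OF V S 3(2) \<alpha>\<beta>(2)]) (simp_all only: \<sigma>_eq d_eq \<sigma>d)
        with pos[OF 3(1)] show ?thesis
          by (rule rational_mean_scale[OF V S 3(1) \<alpha>\<beta>(1), of K \<rho> c])
      qed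
    qed
  qed
qed

section \<open>Matchings and assignments\<close>

text \<open>If \<open>c1\<close> and \<open>c2\<close> were different, \<open>R1 \<inter> R2\<close>
  with \<open>C1 \<union> C2\<close>, and \<open>insert r (R1 \<union> R2)\<close> with
  \<open>C1 \<inter> C2\<close>, would both cover \<open>Z\<close>. Their sizes add up to those of
  the two given covers plus 1, hence to at most \<open>2 * (t - 1) + 1\<close>, so one of them has
  fewer than \<open>t\<close> lines.\<close>

lemma critical_cover_unique_column:
  fixes Z :: "('a \<times> 'b) set"
  assumes cov: "\<And>R C. finite R \<Longrightarrow> finite C \<Longrightarrow> (\<forall>(r, c)\<in>Z. r \<in> R \<or> c \<in> C) \<Longrightarrow> t \<le> card R + card C"
    and Z: "(r, c1) \<in> Z" "(r, c2) \<in> Z"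
    and 1: "finite R1" "finite C1" "\<forall>(r, c)\<in>Z - {(r, c1)}. r \<in> R1 \<or> c \<in> C1" "card R1 + card C1 < t"
    and 2: "finite R2" "finite C2" "\<forall>(r, c)\<in>Z - {(r, c2)}. r \<in> R2 \<or> c \<in> C2" "card R2 + card C2 < t"
  shows "c1 = c2"
proof (rule ccontr)
  assume ne: "c1 \<noteq> c2"
  have n1: "r \<notin> R1" "c1 \<notin> C1" using cov[of R1 C1] 1 by force+
  have n2: "r \<notin> R2" "c2 \<notin> C2" using cov[of R2 C2] 2 by force+
  \<comment> \<open>Each of the two covers still has to cover the edge that the other one misses,
    and cannot do so by row \<open>r\<close>.\<close>
  have i: "c1 \<in> C2" "c2 \<in> C1" using 1(3) 2(3) Z ne n1 n2 by force+
  have Z1: "r' \<in> R1 \<or> c' \<in> C1" if "(r', c') \<in> Z" "(r', c') \<noteq> (r, c1)" for r' c'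
    using 1(3) that by blast
  have Z2: "r' \<in> R2 \<or> c' \<in> C2" if "(r', c') \<in> Z" "(r', c') \<noteq> (r, c2)" for r' c'
    using 2(3) that by blast
  have "\<forall>(r', c')\<in>Z. r' \<in> R1 \<inter> R2 \<or> c' \<in> C1 \<union> C2"
    using Z1 Z2 i by (auto; metis prod.inject)
  then have "t \<le> card (R1 \<inter> R2) + card (C1 \<union> C2)"
    using 1 2 by (intro cov) auto
  moreover have "\<forall>(r', c')\<in>Z. r' \<in> insert r (R1 \<union> R2) \<or> c' \<in> C1 \<inter> C2"
    using Z1 Z2 by (auto; metis prod.inject)
  then have "t \<le> card (insert r (R1 \<union> R2)) + card (C1 \<inter> C2)"
    using 1 2 by (intro cov) auto
  moreover have "card (insert r (R1 \<union> R2)) = Suc (card (R1 \<union> R2))"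
    using n1 n2 1 2 by simp
  ultimately show False
    using card_Un_Int[of R1 R2] card_Un_Int[of C1 C2] 1 2 by linarith
qed

text \<open>
  Koenig's theorem. A set of edges that is minimal among those of cover number at least \<open>t\<close> is a
  matching: otherwise the covers that become available by removing one of two adjacent edges can be
  uncrossed to a cover that is too small.
\<close>
theorem matching_of_cover_number:
  fixes Z :: "('a \<times> 'b) set"
  assumes "finite Z"
    and "\<And>R C. finite R \<Longrightarrow> finite C \<Longrightarrow> (\<forall>(r, c)\<in>Z. r \<in> R \<or> c \<in> C) \<Longrightarrow> t \<le> card R + card C"
  shows "\<exists>M\<subseteq>Z. inj_on fst M \<and> inj_on snd M \<and> t \<le> card M"
  using assms
proof (induction Z rule: finite_psubset_induct)
  case (psubset Z)
  note cov = psubset.prems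
  show ?case
  proof (cases "\<exists>e\<in>Z. \<forall>R C. finite R \<longrightarrow> finite C \<longrightarrow> (\<forall>(r, c)\<in>Z - {e}. r \<in> R \<or> c \<in> C) \<longrightarrow> t \<le> card R + card C")
    case True
    then obtain e where e: "e \<in> Z" "\<And>R C. finite R \<Longrightarrow> finite C \<Longrightarrow> (\<forall>(r, c)\<in>Z - {e}. r \<in> R \<or> c \<in> C) \<Longrightarrow> t \<le> card R + card C"
      by blast
    have "\<exists>M\<subseteq>Z - {e}. inj_on fst M \<and> inj_on snd M \<and> t \<le> card M"
      by (rule psubset.IH) (use e in auto)
    then show ?thesis by blast
  next
    case False
    have crit: "\<exists>R C. finite R \<and> finite C \<and> (\<forall>(r, c)\<in>Z - {e}. r \<in> R \<or> c \<in> C) \<and> card R + card C < t" if "e \<in> Z" for e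
      using False that by (meson not_le)
    have fst_inj: "inj_on fst Z"
    proof (rule inj_onI)
      fix e f assume ef: "e \<in> Z" "f \<in> Z" "fst e = fst f"
      obtain R1 C1 R2 C2 where c:
        "finite R1" "finite C1" "\<forall>(r, c)\<in>Z - {e}. r \<in> R1 \<or> c \<in> C1" "card R1 + card C1 < t"
        "finite R2" "finite C2" "\<forall>(r, c)\<in>Z - {f}. r \<in> R2 \<or> c \<in> C2" "card R2 + card C2 < t"
        using crit[OF ef(1)] crit[OF ef(2)] by metis
      have "(fst e, snd e) \<in> Z" "(fst e, snd f) \<in> Z" "e = (fst e, snd e)" "f = (fst e, snd f)"
        using ef by (auto simp: prod_eq_iff) (metis prod.collapse)
      then have "snd e = snd f"
        by (intro critical_cover_unique_column[of Z t "fst e" "snd e" "snd f" R1 C1 R2 C2, OF cov]) (use c in simp_all)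
      with ef(3) show "e = f" by (simp add: prod_eq_iff)
    qed
    \<comment> \<open>The same uncrossing, applied to the converse relation with rows and columns
      exchanged.\<close>
    have snd_inj: "inj_on snd Z"
    proof (rule inj_onI)
      fix e f assume ef: "e \<in> Z" "f \<in> Z" "snd e = snd f"
      obtain R1 C1 R2 C2 where c:
        "finite R1" "finite C1" "\<forall>(r, c)\<in>Z - {e}. r \<in> R1 \<or> c \<in> C1" "card R1 + card C1 < t"
        "finite R2" "finite C2" "\<forall>(r, c)\<in>Z - {f}. r \<in> R2 \<or> c \<in> C2" "card R2 + card C2 < t"
        using crit[OF ef(1)] crit[OF ef(2)] by metis
      have "(fst e, snd e) \<in> Z" using ef(1) by simp
      moreover have "(fst f, snd e) \<in> Z" unfolding ef(3) using ef(2) by simp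
      ultimately have e': "(snd e, fst e) \<in> Z\<inverse>" "(snd e, fst f) \<in> Z\<inverse>"
        by simp_all
      have "fst e = fst f"
      proof (rule critical_cover_unique_column[of "Z\<inverse>" t "snd e" "fst e" "fst f" C1 R1 C2 R2])
        fix R :: "'b set" and C :: "'a set"
        assume "finite R" "finite C" "\<forall>(r, c)\<in>Z\<inverse>. r \<in> R \<or> c \<in> C"
        then show "t \<le> card R + card C"
          using cov[of C R] by (simp add: add.commute) blast
      next
        show "\<forall>(r, c)\<in>Z\<inverse> - {(snd e, fst e)}. r \<in> C1 \<or> c \<in> R1"
          using c(3) by (cases e) auto
        show "\<forall>(r, c)\<in>Z\<inverse> - {(snd e, fst f)}. r \<in> C2 \<or> c \<in> R2"
          using c(7) ef(3) by (cases f) auto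
      qed (use c e' in simp_all)
      with ef(3) show "e = f" by (simp add: prod_eq_iff)
    qed
    \<comment> \<open>The rows of \<open>Z\<close> alone form a cover; since \<open>Z\<close> is a
      matching, there are as many of them as edges.\<close>
    have "t \<le> card (fst ` Z) + card ({} :: 'b set)"
      by (rule cov) (use psubset.hyps in force)+
    then have "t \<le> card Z" using card_image[OF fst_inj] by simp
    with fst_inj snd_inj show ?thesis by blast
  qed
qed

text \<open>Every edge of a matching needs a line of its own. A cover with no more lines than edges
  has none to spare, so each of its columns is the column of an edge.\<close>

lemma tight_cover_columns:
  assumes M: "finite M" "inj_on snd M" "inj_on fst M"
    and cov: "finite R" "finite C" "\<forall>(r, c)\<in>M. r \<in> R \<or> c \<in> C" "card R + card C \<le> card M"
  shows "C \<subseteq> snd ` M"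
proof -
  have "card M \<le> card ({e \<in> M. fst e \<in> R} \<union> {e \<in> M. snd e \<in> C})"
    using M cov by (intro card_mono) auto
  also have "\<dots> \<le> card {e \<in> M. fst e \<in> R} + card {e \<in> M. snd e \<in> C}"
    by (rule card_Un_le)
  also have "card {e \<in> M. fst e \<in> R} \<le> card R"
    using M cov by (intro card_inj_on_le[of fst]) (auto intro: inj_on_subset)
  also have "card {e \<in> M. snd e \<in> C} \<le> card (C \<inter> snd ` M)"
    using M cov by (intro card_inj_on_le[of snd]) (auto intro: inj_on_subset)
  finally have "card C \<le> card (C \<inter> snd ` M)" using cov by simp
  then have "C \<inter> snd ` M = C" using cov by (intro card_seteq) auto
  then show ?thesis by blast
qed

section \<open>Assignments that use all columns of \<open>D\<close>\<close>

definition assignments_in :: "nat \<Rightarrow> nat \<Rightarrow> nat \<Rightarrow> (nat \<times> nat) set set" where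
  "assignments_in m n k = {S. S \<subseteq> {1..m} \<times> {1..n} \<and> card S = k \<and> inj_on fst S \<and> inj_on snd S}"

definition saturating :: "nat \<Rightarrow> nat \<Rightarrow> nat \<Rightarrow> nat set \<Rightarrow> (nat \<times> nat) set set" where
  "saturating m n k D = {S \<in> assignments_in m n k. D \<subseteq> snd ` S}"

lemma finite_assignments_in: "finite (assignments_in m n k)"
  by (rule finite_subset[of _ "Pow ({1..m} \<times> {1..n})"]) (auto simp: assignments_in_def)

lemma finite_saturating: "finite (saturating m n k D)"
  unfolding saturating_def using finite_assignments_in by auto

lemma finite_assignment: "S \<in> assignments_in m n k \<Longrightarrow> finite S"
  by (auto simp: assignments_in_def dest: finite_subset)

lemma saturating_mono: "n \<le> n' \<Longrightarrow> saturating m n k D \<subseteq> saturating m n' k D"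
  unfolding saturating_def assignments_in_def by force

lemma exchange_in_assignment:
  assumes S: "S \<in> assignments_in m n k" "e \<in> S" "(r, c) \<in> {1..m} \<times> {1..n}"
    "r \<notin> fst ` (S - {e})" "c \<notin> snd ` (S - {e})"
    and w: "w (r, c) \<le> (w e :: real)"
  shows "insert (r, c) (S - {e}) \<in> assignments_in m n k"
    and "sum w (insert (r, c) (S - {e})) \<le> sum w S"
proof -
  have f: "finite S" using S finite_assignment by auto
  have ni: "(r, c) \<notin> S - {e}" using S(4) by force
  have "card (insert (r, c) (S - {e})) = card S"
    using card_insert_disjoint[OF finite_Diff[OF f] ni] card_Suc_Diff1[OF f S(2)] by simp
  moreover have "inj_on fst (insert (r, c) (S - {e}))" "inj_on snd (insert (r, c) (S - {e}))"
    using S ni by (auto simp: assignments_in_def inj_on_insert intro: inj_on_subset)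
  ultimately show "insert (r, c) (S - {e}) \<in> assignments_in m n k"
    using S by (auto simp: assignments_in_def)
  show "sum w (insert (r, c) (S - {e})) \<le> sum w S"
    using f ni w S(2) by (simp add: sum.remove[of S e])
qed

text \<open>
  Each exchange brings a further edge of \<open>M\<close> into the assignment.
\<close>
lemma saturate_columns:
  fixes w :: "nat \<times> nat \<Rightarrow> real"
  assumes M: "M \<subseteq> {1..m} \<times> {1..n}" "inj_on fst M" "inj_on snd M" "snd ` M = D" "card D \<le> k"
    and w: "\<And>p. p \<in> {1..m} \<times> {1..n} \<Longrightarrow> 0 \<le> w p" "\<And>p. p \<in> M \<Longrightarrow> w p = 0"
    and S: "S \<in> assignments_in m n k"
  shows "\<exists>S'\<in>saturating m n k D. sum w S' \<le> sum w S"
  using S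
proof (induction "k - card (S \<inter> M)" arbitrary: S rule: less_induct)
  case less
  note S = less.prems
  have fS: "finite S" using finite_assignment[OF S] .
  have cS: "card S = k" "inj_on fst S" "inj_on snd S" "S \<subseteq> {1..m} \<times> {1..n}"
    using S by (auto simp: assignments_in_def)
  show ?case
  proof (cases "D \<subseteq> snd ` S")
    case True
    with S show ?thesis unfolding saturating_def by auto
  next
    case False
    then obtain c where "c \<in> snd ` M" and cD: "c \<notin> snd ` S" "c \<in> D" using M(4) by blast
    then obtain r where rc: "(r, c) \<in> M" "c \<notin> snd ` S" "c \<in> D" by auto
    \<comment> \<open>The edge \<open>e\<close> makes room for \<open>(r, c)\<close>. An edge of
      \<open>S\<close> in row \<open>r\<close> cannot be in \<open>M\<close>, whose only edge in
      that row is \<open>(r, c)\<close>. If row \<open>r\<close> is free, any edge of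
      \<open>S\<close> in a column outside \<open>D\<close> will do. It exists because
      \<open>S\<close> has at least \<open>card D\<close> edges and misses column \<open>c\<close>
      of \<open>D\<close>.\<close>
    have "\<exists>e\<in>S. e \<notin> M \<and> r \<notin> fst ` (S - {e})"
    proof (cases "r \<in> fst ` S")
      case True
      then obtain e where e: "e \<in> S" "fst e = r" by auto
      have "r \<notin> fst ` (S - {e})" using e cS(2) by (auto simp: inj_on_def)
      moreover have "e \<notin> M"
      proof
        assume "e \<in> M"
        then have "e = (r, c)" using inj_onD[OF M(2), of e "(r, c)"] e(2) rc(1) by simp
        with e(1) rc(2) show False by force
      qed
      ultimately show ?thesis using e by blast
    next
      case False
      have "\<not> snd ` S \<subseteq> D - {c}"
      proof
        assume "snd ` S \<subseteq> D - {c}"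
        moreover have fD: "finite D" using M finite_subset[OF M(1)] by auto
        ultimately have "card (snd ` S) \<le> card (D - {c})" by (intro card_mono) auto
        also have "\<dots> < card D" using fD rc by (intro psubset_card_mono) auto
        finally show False using M cS by (simp add: card_image)
      qed
      then obtain e where "e \<in> S" "snd e \<notin> D" using rc by auto
      then show ?thesis using False M by force
    qed
    then obtain e where e: "e \<in> S" "e \<notin> M" "r \<notin> fst ` (S - {e})" by auto
    let ?S = "insert (r, c) (S - {e})"
    have c: "c \<notin> snd ` (S - {e})" using rc by auto
    have "w (r, c) \<le> w e" using w rc e cS by auto
    note ex = exchange_in_assignment[OF S e(1) _ e(3) c this]
    have rcm: "(r, c) \<in> {1..m} \<times> {1..n}" using rc M by auto
    have "(r, c) \<notin> S" using rc(2) by force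
    then have "S \<inter> M \<subset> ?S \<inter> M" using e(2) rc(1) by blast
    then have "card (S \<inter> M) < card (?S \<inter> M)" using fS by (intro psubset_card_mono) auto
    moreover have "card (?S \<inter> M) \<le> card ?S" using fS by (intro card_mono) auto
    moreover have "card ?S = k" using ex(1)[OF rcm] by (simp add: assignments_in_def)
    ultimately have "k - card (?S \<inter> M) < k - card (S \<inter> M)" by linarith
    from less.hyps[OF this ex(1)[OF rcm]] obtain S' where "S' \<in> saturating m n k D" "sum w S' \<le> sum w ?S"
      by auto
    with ex(2)[OF rcm] show ?thesis by (intro bexI[of _ S']) auto
  qed
qed

lemma restrict_to_revealed:
  fixes w :: "nat \<times> nat \<Rightarrow> real"
  assumes H: "H \<subseteq> {1..m} \<times> {1..n0}" "{1..m} \<times> D \<subseteq> H" "n0 \<le> n"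
    and full: "\<And>r. r \<in> {1..m} \<Longrightarrow> k \<le> card {c. (r, c) \<in> H \<and> c \<notin> D} + card D"
    and w: "\<And>r c c'. (r, c) \<in> H \<Longrightarrow> c \<notin> D \<Longrightarrow> (r, c') \<in> {1..m} \<times> {1..n} - H \<Longrightarrow> w (r, c) \<le> w (r, c')"
    and S: "S \<in> saturating m n k D"
  shows "\<exists>S'\<in>saturating m n0 k D. S' \<subseteq> H \<and> sum w S' \<le> sum w S"
  using S
proof (induction "card (S - H)" arbitrary: S rule: less_induct)
  case less
  have S: "S \<in> assignments_in m n k" and SD: "D \<subseteq> snd ` S"
    using less.prems by (auto simp: saturating_def)
  have fS: "finite S" using finite_assignment[OF S] .
  have cS: "card S = k" "inj_on fst S" "inj_on snd S" "S \<subseteq> {1..m} \<times> {1..n}"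
    using S by (auto simp: assignments_in_def)
  show ?case
  proof (cases "S \<subseteq> H")
    case True
    with H(1) have "S \<subseteq> {1..m} \<times> {1..n0}" by (rule order_trans[rotated])
    with S SD have "S \<in> saturating m n0 k D" by (simp add: saturating_def assignments_in_def)
    with True show ?thesis by auto
  next
    case False
    then obtain r c where rc: "(r, c) \<in> S" "(r, c) \<notin> H" by force
    have r: "r \<in> {1..m}" "c \<notin> D" using rc cS H by auto
    let ?K = "{c. (r, c) \<in> H \<and> c \<notin> D}"
    have "\<not> ?K \<subseteq> snd ` S - D - {c}"
    proof
      assume "?K \<subseteq> snd ` S - D - {c}"
      then have "card ?K \<le> card (snd ` S - D - {c})" using fS by (intro card_mono) auto
      also have "\<dots> < card (snd ` S - D)" using fS rc r by (intro psubset_card_mono) force+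
      also have "\<dots> = k - card D"
        using SD fS cS finite_subset[OF SD] by (simp add: card_Diff_subset card_image)
      finally show False using full[OF r(1)] by simp
    qed
    then obtain c' where c': "(r, c') \<in> H" "c' \<notin> D" "c' \<notin> snd ` S" using rc by auto
    have rn: "r \<notin> fst ` (S - {(r, c)})" using rc cS(2) by (force simp: inj_on_def)
    have cn: "c' \<notin> snd ` (S - {(r, c)})" using c' by auto
    have "w (r, c') \<le> w (r, c)" using w[OF c'(1,2)] rc cS by auto
    note ex = exchange_in_assignment[OF S rc(1) _ rn cn this]
    let ?S = "insert (r, c') (S - {(r, c)})"
    have pos: "(r, c') \<in> {1..m} \<times> {1..n}" using c' H by auto
    have "D \<subseteq> snd ` ?S" using SD r(2) by force
    then have "?S \<in> saturating m n k D" using ex(1)[OF pos] by (simp add: saturating_def)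
    moreover have "card (?S - H) < card (S - H)"
      using fS rc c' by (intro psubset_card_mono) auto
    ultimately obtain S' where "S' \<in> saturating m n0 k D" "S' \<subseteq> H" "sum w S' \<le> sum w ?S"
      using less.hyps by blast
    with ex(2)[OF pos] show ?thesis by (intro bexI[of _ S']) auto
  qed
qed

section \<open>Partially revealed matrices\<close>

text \<open>Serves to permute variables, to rename them, and, when \<open>f\<close> is not onto
  \<open>I\<close>, to integrate out those that \<open>G\<close> does not see.\<close>

lemma nn_integral_expo_prod_reindex:
  assumes f: "inj_on f J" "f ` J \<subseteq> I" and G: "G \<in> borel_measurable (Pi\<^sub>M J (\<lambda>_. borel))"
  shows "(\<integral>\<^sup>+y. G (\<lambda>j\<in>J. y (f j)) \<partial>expo_prod I \<rho>) = (\<integral>\<^sup>+x. G x \<partial>expo_prod J (\<lambda>j. \<rho> (f j)))"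
proof -
  have m: "(\<lambda>y. \<lambda>j\<in>J. y (f j)) \<in> expo_prod I \<rho> \<rightarrow>\<^sub>M expo_prod J (\<lambda>j. \<rho> (f j))"
  proof -
    have "(\<lambda>y. \<lambda>j\<in>J. y (f j)) \<in> Pi\<^sub>M I (\<lambda>_. borel :: real measure) \<rightarrow>\<^sub>M Pi\<^sub>M J (\<lambda>_. borel :: real measure)"
      using f by (intro measurable_restrict measurable_component_singleton) auto
    then show ?thesis by (simp cong: measurable_cong_sets)
  qed
  have "expo_prod J (\<lambda>j. \<rho> (f j)) = distr (expo_prod I \<rho>) (expo_prod J (\<lambda>j. \<rho> (f j))) (\<lambda>y. \<lambda>j\<in>J. y (f j))"
    unfolding expo_prod_def using f by (intro distr_PiM_reindex[symmetric] prob_space_expo) auto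
  then have "(\<integral>\<^sup>+x. G x \<partial>expo_prod J (\<lambda>j. \<rho> (f j))) =
      (\<integral>\<^sup>+x. G x \<partial>distr (expo_prod I \<rho>) (expo_prod J (\<lambda>j. \<rho> (f j))) (\<lambda>y. \<lambda>j\<in>J. y (f j)))"
    by metis
  also have "\<dots> = (\<integral>\<^sup>+y. G (\<lambda>j\<in>J. y (f j)) \<partial>expo_prod I \<rho>)"
    using m G by (intro nn_integral_distr) (simp_all cong: measurable_cong_sets)
  finally show ?thesis ..
qed

lemma Min_image_dominated:
  fixes g :: "'a \<Rightarrow> 'b :: linorder"
  assumes "finite B" "A \<subseteq> B" "A \<noteq> {}" "\<And>b. b \<in> B \<Longrightarrow> \<exists>a\<in>A. g a \<le> g b"
  shows "Min (g ` B) = Min (g ` A)"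
proof (rule antisym)
  have fA: "finite A" using assms finite_subset by auto
  show "Min (g ` B) \<le> Min (g ` A)" using assms by (intro Min_antimono) auto
  have "Min (g ` A) \<le> g b" if "b \<in> B" for b
  proof -
    from assms(4)[OF that] obtain a where "a \<in> A" "g a \<le> g b" by auto
    then show ?thesis using fA by (meson Min_le finite_imageI imageI order_trans)
  qed
  then show "Min (g ` A) \<le> Min (g ` B)" using assms by (subst Min_ge_iff) auto
qed

text \<open>
  A partially revealed matrix. The positions in \<open>H\<close> are revealed: they contain a linear form, with
  coefficients \<open>A p\<close>, in the variables indexed by \<open>V\<close>. A hidden entry \<open>(r, c)\<close> exceeds the form
  \<open>B r\<close> of its row by a variable of its own, indexed by \<open>(r, c)\<close>, of rate 1. When a position is
  revealed its variable joins \<open>V\<close>. Indices \<open>(0, i)\<close> are those of the variables given at the start.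
\<close>
definition ent :: "(nat \<times> nat) set \<Rightarrow> (nat \<times> nat) set \<Rightarrow> (nat \<times> nat \<Rightarrow> nat \<times> nat \<Rightarrow> real) \<Rightarrow>
    (nat \<Rightarrow> nat \<times> nat \<Rightarrow> real) \<Rightarrow> (nat \<times> nat \<Rightarrow> real) \<Rightarrow> nat \<times> nat \<Rightarrow> real" where
  "ent V H A B y p =
     (if p \<in> H then \<Sum>v\<in>V. A p v * y v else (\<Sum>v\<in>V. B (fst p) v * y v) + y p)"

definition sat_cost where
  "sat_cost m n k D V H A B y = Min ((\<lambda>S. \<Sum>p\<in>S. ent V H A B y p) ` saturating m n k D)"

definition hidden :: "nat \<Rightarrow> nat \<Rightarrow> (nat \<times> nat) set \<Rightarrow> (nat \<times> nat) set" where
  "hidden m n H = {1..m} \<times> {1..n} - H"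

text \<open>\<open>n\<close> enters only through the number of columns and as the argument of the
  rates; the description of the revealed part is the same for all \<open>n\<close>.\<close>

definition sat_mean where
  "sat_mean m n k D V \<rho> H A B =
     (\<integral>\<^sup>+y. ennreal (sat_cost m n k D V H A B y)
        \<partial>expo_prod (V \<union> hidden m n H) (\<lambda>v. if v \<in> V then \<rho> v (real n) else 1))"

text \<open>\<open>A_le_B\<close> records that outside \<open>D\<close> the entries of a row are
  revealed in increasing order; entries in \<open>D\<close> are arbitrary and therefore revealed
  from the start. Rows are numbered from 1, so \<open>V_subset\<close> separates \<open>V\<close>
  from the indices of hidden entries. The support conditions ensure that a new index in
  \<open>V\<close> leaves the old forms unchanged.\<close>

locale partial_matrix =
  fixes k m n0 :: nat and D :: "nat set" and V :: "(nat \<times> nat) set"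
    and \<rho> :: "nat \<times> nat \<Rightarrow> real \<Rightarrow> real" and H :: "(nat \<times> nat) set"
    and A :: "nat \<times> nat \<Rightarrow> nat \<times> nat \<Rightarrow> real" and B :: "nat \<Rightarrow> nat \<times> nat \<Rightarrow> real"
  assumes finite_V: "finite V"
    and D_revealed: "{1..m} \<times> D \<subseteq> H"
    and H_subset: "H \<subseteq> {1..m} \<times> {1..n0}"
    and V_subset: "V \<subseteq> {0} \<times> UNIV \<union> H"
    and rate_rational: "\<And>v. v \<in> V \<Longrightarrow> rational_from (real k) (\<rho> v)"
    and rate_pos: "\<And>v x. v \<in> V \<Longrightarrow> x \<ge> real k \<Longrightarrow> 0 < \<rho> v x"
    and A_nonneg: "\<And>p v. 0 \<le> A p v"
    and B_nonneg: "\<And>r v. 0 \<le> B r v"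
    and A_support: "\<And>p v. v \<notin> V \<Longrightarrow> A p v = 0"
    and B_support: "\<And>r v. v \<notin> V \<Longrightarrow> B r v = 0"
    and A_le_B: "\<And>r c v. (r, c) \<in> H \<Longrightarrow> c \<notin> D \<Longrightarrow> A (r, c) v \<le> B r v"
    and D_subset: "D \<subseteq> {1..n0}"
    and card_D: "card D \<le> k"
    and k_le: "k \<le> n0"
    and saturating_nonempty: "saturating m n0 k D \<noteq> {}"

section \<open>Measurability of the cost, and the effect of revealing one entry\<close>

lemma finite_hidden: "finite (hidden m n H)"
  by (simp add: hidden_def)

lemma measurable_sat_cost:
  assumes "V \<union> hidden m n H \<subseteq> I"
  shows "(\<lambda>y. ennreal (sat_cost m n k D V H A B y)) \<in> borel_measurable (Pi\<^sub>M I (\<lambda>_. borel))"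
proof -
  have comp [measurable]: "(\<lambda>y. y i) \<in> borel_measurable (Pi\<^sub>M I (\<lambda>_. borel))" if "i \<in> V \<union> hidden m n H" for i
    using that assms by (intro measurable_component_singleton) auto
  have [measurable]: "(\<lambda>y. ent V H A B y p) \<in> borel_measurable (Pi\<^sub>M I (\<lambda>_. borel))" if "p \<in> {1..m} \<times> {1..n}" for p
  proof (cases "p \<in> H")
    case True
    then show ?thesis unfolding ent_def by simp
  next
    case False
    then have "(\<lambda>y. y p) \<in> borel_measurable (Pi\<^sub>M I (\<lambda>_. borel))"
      using that by (intro comp) (auto simp: hidden_def)
    moreover have "(\<lambda>y. \<Sum>v\<in>V. B (fst p) v * y v) \<in> borel_measurable (Pi\<^sub>M I (\<lambda>_. borel))"
      by measurable
    ultimately have "(\<lambda>y. (\<Sum>v\<in>V. B (fst p) v * y v) + y p) \<in> borel_measurable (Pi\<^sub>M I (\<lambda>_. borel))"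
      by (rule borel_measurable_add[rotated])
    with False show ?thesis by (simp add: ent_def)
  qed
  have "(\<lambda>y. \<Sum>p\<in>S. ent V H A B y p) \<in> borel_measurable (Pi\<^sub>M I (\<lambda>_. borel))" if "S \<in> saturating m n k D" for S
    using that by (intro borel_measurable_sum) (auto simp: saturating_def assignments_in_def)
  then have "sat_cost m n k D V H A B \<in> borel_measurable (Pi\<^sub>M I (\<lambda>_. borel))"
    unfolding sat_cost_def using finite_saturating by (intro borel_measurable_Min) auto
  then show ?thesis by simp
qed

text \<open>The entry just revealed is the new lower bound of the hidden part of its row. Therefore
  \<open>B r\<close> gains the new variable, with coefficient 1, and the remaining hidden entries
  are measured from there.\<close>

lemma ent_reveal:
  assumes V: "finite V" "(r, c) \<notin> V"
    and A: "A p (r, c) = 0" and B: "\<And>i. B i (r, c) = 0"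
  shows "ent (insert (r, c) V) (insert (r, c) H) (A((r, c) := (B r)((r, c) := 1)))
      (B(r := (B r)((r, c) := 1))) y p =
    (if p = (r, c) then (\<Sum>v\<in>V. B r v * y v) + y (r, c)
     else if p \<in> H then \<Sum>v\<in>V. A p v * y v
     else (\<Sum>v\<in>V. B (fst p) v * y v) + (if fst p = r then y (r, c) else 0) + y p)"
proof -
  have 1: "(\<Sum>v\<in>insert (r, c) V. ((B r)((r, c) := 1)) v * y v) = (\<Sum>v\<in>V. B r v * y v) + y (r, c)"
  proof -
    have "(\<Sum>v\<in>V. ((B r)((r, c) := 1)) v * y v) = (\<Sum>v\<in>V. B r v * y v)"
      using V by (intro sum.cong) auto
    then show ?thesis using V by (simp del: fun_upd_apply) simp
  qed
  have 2: "(\<Sum>v\<in>insert (r, c) V. A p v * y v) = (\<Sum>v\<in>V. A p v * y v)" using V A by simp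
  have 3: "(\<Sum>v\<in>insert (r, c) V. B i v * y v) = (\<Sum>v\<in>V. B i v * y v)" for i using V B by simp
  consider "p = (r, c)" | "p \<noteq> (r, c)" "p \<in> H" | "p \<noteq> (r, c)" "p \<notin> H" "fst p = r"
    | "p \<noteq> (r, c)" "p \<notin> H" "fst p \<noteq> r" by blast
  then show ?thesis
    by cases (simp_all only: ent_def insert_iff fun_upd_same fun_upd_other simp_thms if_True if_False
        1 2 3 not_False_eq_True add_0_right)
qed

text \<open>If \<open>(r, c)\<close> wins the race among the hidden entries of row \<open>r\<close>,
  then \<open>race_map\<close> adds \<open>y (r, c)\<close> to its rivals. The updated
  \<open>B r\<close> adds the same amount to these entries, so a race and an update of the matrix
  are two descriptions of one change.\<close>

lemma (in partial_matrix) sat_cost_reveal: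
  assumes rc: "(r, c) \<in> hidden m n H"
  shows "sat_cost m n k D V H A B (race_map {(r, c') |c'. (r, c') \<in> hidden m n H} (r, c) y) =
    sat_cost m n k D (insert (r, c) V) (insert (r, c) H) (A((r, c) := (B r)((r, c) := 1)))
      (B(r := (B r)((r, c) := 1))) y"
proof -
  let ?Q = "{(r, c') |c'. (r, c') \<in> hidden m n H}"
  note V = finite_V V_subset and A = A_support and B = B_support
  have VQ: "v \<notin> ?Q" if "v \<in> V" for v using that V(2) by (auto simp: hidden_def)
  have rcV: "(r, c) \<notin> V" using VQ rc by blast
  have yV: "race_map ?Q (r, c) y v = y v" if "v \<in> V" for v
  proof -
    have "v \<notin> ?Q - {(r, c)}" using VQ[OF that] by blast
    then show ?thesis unfolding race_map_def by (rule if_not_P)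
  qed
  have sumV: "(\<Sum>v\<in>V. g v * race_map ?Q (r, c) y v) = (\<Sum>v\<in>V. g v * y v)" for g :: "nat \<times> nat \<Rightarrow> real"
    by (intro sum.cong) (simp_all only: yV)
  have "ent V H A B (race_map ?Q (r, c) y) p =
    ent (insert (r, c) V) (insert (r, c) H) (A((r, c) := (B r)((r, c) := 1))) (B(r := (B r)((r, c) := 1))) y p"
    if p: "p \<in> {1..m} \<times> {1..n}" for p
  proof -
    have "race_map ?Q (r, c) y p = (if p = (r, c) then y (r, c) else (if fst p = r then y (r, c) else 0) + y p)"
      if "p \<notin> H"
      using that p by (cases p) (auto simp: race_map_def hidden_def)
    moreover have "(r, c) \<notin> H" using rc by (simp add: hidden_def)
    ultimately show ?thesis
      using ent_reveal[of V r c A p B H y, OF V(1) rcV A[OF rcV] B[OF rcV]]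
      by (auto simp: ent_def sumV)
  qed
  then have "(\<Sum>p\<in>S. ent V H A B (race_map ?Q (r, c) y) p) = (\<Sum>p\<in>S. ent (insert (r, c) V) (insert (r, c) H)
      (A((r, c) := (B r)((r, c) := 1))) (B(r := (B r)((r, c) := 1))) y p)" if "S \<in> saturating m n k D" for S
    using that by (intro sum.cong) (auto simp: saturating_def assignments_in_def)
  then show ?thesis unfolding sat_cost_def by (intro arg_cong[where f = Min] image_cong) auto
qed

text \<open>At the new position \<open>A_le_B\<close> holds with equality, and older entries of the
  row stay below \<open>B r\<close>, which only gains a coefficient. The column bound may have to
  grow to \<open>n1\<close>, because the revealed column may lie beyond \<open>n0\<close>.\<close>

lemma (in partial_matrix) partial_matrix_reveal:
  assumes rc: "(r, c) \<in> hidden m n1 H" and n1: "n0 \<le> n1"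
    and g: "rational_from (real k) g" "\<And>x. x \<ge> real k \<Longrightarrow> 0 < g x"
  shows "partial_matrix k m n1 D (insert (r, c) V) (\<rho>((r, c) := g)) (insert (r, c) H)
    (A((r, c) := (B r)((r, c) := 1))) (B(r := (B r)((r, c) := 1)))"
proof -
  have rc': "(r, c) \<notin> H" "r \<in> {1..m}" "c \<in> {1..n1}" using rc by (auto simp: hidden_def)
  have rcV: "(r, c) \<notin> V" using rc' V_subset by auto
  show ?thesis
  proof
    fix r' c' v assume h: "(r', c') \<in> insert (r, c) H" "c' \<notin> D"
    show "(A((r, c) := (B r)((r, c) := 1))) (r', c') v \<le> (B(r := (B r)((r, c) := 1))) r' v"
    proof (cases "(r', c') = (r, c)")
      case False
      then have "(r', c') \<in> H" using h(1) by blast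
      then have "A (r', c') v \<le> B r' v" using h(2) by (rule A_le_B)
      moreover have "A (r', c') (r, c) = 0" using A_support[OF rcV] .
      ultimately show ?thesis using False by auto
    qed auto
  next
    show "insert (r, c) H \<subseteq> {1..m} \<times> {1..n1}" using H_subset rc' n1 by fastforce
    show "saturating m n1 k D \<noteq> {}" using saturating_mono[OF n1] saturating_nonempty by blast
    show "D \<subseteq> {1..n1}" using D_subset n1 by fastforce
    show "{1..m} \<times> D \<subseteq> insert (r, c) H" using D_revealed by auto
    show "insert (r, c) V \<subseteq> {0} \<times> UNIV \<union> insert (r, c) H" using V_subset by auto
    show "rational_from (real k) ((\<rho>((r, c) := g)) v)" if "v \<in> insert (r, c) V" for v
      using that rate_rational g by (cases "v = (r, c)") auto
    show "0 < (\<rho>((r, c) := g)) v x" if "v \<in> insert (r, c) V" "x \<ge> real k" for v x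
      using that rate_pos g by (cases "v = (r, c)") auto
    show "0 \<le> (A((r, c) := (B r)((r, c) := 1))) p v" for p v
      using A_nonneg B_nonneg by (cases "p = (r, c)") auto
    show "0 \<le> (B(r := (B r)((r, c) := 1))) i v" for i v
      using B_nonneg by (cases "i = r") auto
    show "(A((r, c) := (B r)((r, c) := 1))) p v = 0" if "v \<notin> insert (r, c) V" for p v
      using that A_support B_support by (cases "p = (r, c)") auto
    show "(B(r := (B r)((r, c) := 1))) i v = 0" if "v \<notin> insert (r, c) V" for i v
      using that B_support by (cases "i = r") auto
  qed (use finite_V card_D k_le n1 in auto)
qed

section \<open>Symmetry of the columns beyond \<open>n0\<close>\<close>

text \<open>The map acts on indices of variables as well as on positions. Indices with first
  component 0 name given variables, so their second component is not a column and is kept.\<close>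

definition swap_columns :: "nat \<Rightarrow> nat \<Rightarrow> nat \<times> nat \<Rightarrow> nat \<times> nat" where
  "swap_columns c c' p = (fst p, if fst p = 0 then snd p else if snd p = c then c' else if snd p = c' then c else snd p)"

lemma swap_columns_involution: "swap_columns c c' (swap_columns c c' p) = p"
  by (auto simp: swap_columns_def prod_eq_iff)

lemma inj_swap_columns: "inj_on (swap_columns c c') I"
  by (metis inj_onI swap_columns_involution)

lemma swap_columns_saturating:
  assumes S: "S \<in> saturating m n k D" and "c \<in> {1..n}" "c' \<in> {1..n}" "c \<notin> D" "c' \<notin> D"
  shows "swap_columns c c' ` S \<in> saturating m n k D"
proof -
  let ?f = "swap_columns c c'"
  let ?g = "\<lambda>j. if j = c then c' else if j = c' then c else j"
  have S': "S \<subseteq> {1..m} \<times> {1..n}" "card S = k" "inj_on fst S" "inj_on snd S" "D \<subseteq> snd ` S"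
    using S by (auto simp: saturating_def assignments_in_def)
  have f: "fst (?f p) = fst p" "snd (?f p) = ?g (snd p)" if "p \<in> S" for p
    using that S'(1) by (auto simp: swap_columns_def)
  have "?f ` S \<subseteq> {1..m} \<times> {1..n}" using S'(1) assms by (auto simp: swap_columns_def)
  moreover have "card (?f ` S) = k" using S'(2) by (simp add: card_image inj_swap_columns)
  moreover have "inj_on fst (?f ` S)"
  proof (rule inj_onI, elim imageE)
    fix p q p' q' assume "fst p = fst q" "p = ?f p'" "p' \<in> S" "q = ?f q'" "q' \<in> S"
    then show "p = q" using f(1) inj_onD[OF S'(3), of p' q'] by simp
  qed
  moreover have "inj_on snd (?f ` S)"
  proof (rule inj_onI, elim imageE)
    fix p q p' q' assume *: "snd p = snd q" "p = ?f p'" "p' \<in> S" "q = ?f q'" "q' \<in> S"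
    then have "?g (snd p') = ?g (snd q')" using f(2) by simp
    then have "snd p' = snd q'" by (simp split: if_splits)
    then show "p = q" using * inj_onD[OF S'(4), of p' q'] by simp
  qed
  moreover have "D \<subseteq> snd ` ?f ` S"
  proof
    fix d assume d: "d \<in> D"
    then obtain p where p: "p \<in> S" "snd p = d" using S'(5) by auto
    then have "snd (?f p) = d" using f(2)[OF p(1)] d assms by auto
    then show "d \<in> snd ` ?f ` S" using p by force
  qed
  ultimately show ?thesis by (simp add: saturating_def assignments_in_def)
qed

text \<open>Everything in \<open>V\<close> and \<open>H\<close> lies in the first \<open>n0\<close>
  columns or has first component 0, so swapping two later columns fixes it. The swap merely permutes
  hidden variables, all of rate 1, and it permutes the admissible assignments because neither column
  is in \<open>D\<close>.\<close>

lemma (in partial_matrix) sat_mean_reveal_swap: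
  assumes r: "r \<in> {1..m}"
    and c: "n0 < c" "c \<le> n" and c': "n0 < c'" "c' \<le> n"
  shows "sat_mean m n k D (insert (r, c) V) (\<rho>((r, c) := g)) (insert (r, c) H)
      (A((r, c) := (B r)((r, c) := 1))) (B(r := (B r)((r, c) := 1))) =
    sat_mean m n k D (insert (r, c') V) (\<rho>((r, c') := g)) (insert (r, c') H)
      (A((r, c') := (B r)((r, c') := 1))) (B(r := (B r)((r, c') := 1)))"
proof -
  note st = finite_V H_subset V_subset D_subset and supp = A_support B_support
  let ?f = "swap_columns c c'"
  define I where "I = V \<union> hidden m n H"
  have rV: "(r, j) \<notin> V" "(r, j) \<notin> H" if "n0 < j" for j using st r that by auto
  have I: "insert (r, j) V \<union> hidden m n (insert (r, j) H) = I" if "n0 < j" "j \<le> n" for j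
    using r that rV[OF that(1)] by (auto simp: I_def hidden_def)
  have fV: "?f v = v" if "v \<in> V \<union> H" for v
  proof -
    have "v \<in> {0} \<times> UNIV \<union> {1..m} \<times> {1..n0}" using that st(2,3) by blast
    then have "fst v = 0 \<or> snd v \<le> n0" by auto
    with c c' show ?thesis by (auto simp: swap_columns_def prod_eq_iff)
  qed
  have fpos: "?f p \<in> {1..m} \<times> {1..n}" if "p \<in> {1..m} \<times> {1..n}" for p
    using that c c' by (auto simp: swap_columns_def)
  have fhid: "?f p \<in> hidden m n H" if "p \<in> hidden m n H" for p
    using that fV fpos swap_columns_involution[of c c' p] unfolding hidden_def by (metis Diff_iff UnCI)
  have fI: "?f ` I \<subseteq> I" using fV fhid by (auto simp: I_def)
  have fr: "?f (r, c') = (r, c)" "?f (r, c) = (r, c')" using r by (auto simp: swap_columns_def)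
  define F where "F j y = ennreal (sat_cost m n k D (insert (r, j) V) (insert (r, j) H)
      (A((r, j) := (B r)((r, j) := 1))) (B(r := (B r)((r, j) := 1))) y)" for j y
  define R where "R j v = (if v \<in> insert (r, j) V then (\<rho>((r, j) := g)) v (real n) else 1)" for j v
  have R: "R c' = (\<lambda>v. R c (?f v))"
  proof
    fix v
    show "R c' v = R c (?f v)"
    proof (cases "v = (r, c')")
      case True
      then show ?thesis using rV(1)[OF c(1)] rV(1)[OF c'(1)] by (simp add: R_def fr)
    next
      case False
      then have 1: "?f v \<noteq> (r, c)" using fr swap_columns_involution by metis
      have 2: "?f v \<in> V \<longleftrightarrow> v \<in> V" using fV swap_columns_involution[of c c' v] by (metis UnCI)
      have "?f v = v" if "v \<in> V" using fV that by simp
      with False 1 2 rV(1)[OF c(1)] rV(1)[OF c'(1)] show ?thesis by (auto simp: R_def)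
    qed
  qed
  have meas: "F c' \<in> borel_measurable (Pi\<^sub>M I (\<lambda>_. borel))"
    unfolding F_def by (rule measurable_sat_cost) (simp only: I[OF c'] order_refl)
  have F: "F c' (\<lambda>j\<in>I. y (?f j)) = F c y" for y
  proof -
    let ?y = "\<lambda>j\<in>I. y (?f j)"
    let ?e = "\<lambda>j. ent (insert (r, j) V) (insert (r, j) H) (A((r, j) := (B r)((r, j) := 1))) (B(r := (B r)((r, j) := 1)))"
    have yV: "?y v = y v" if "v \<in> V" for v using that fV by (simp add: I_def)
    have sumV: "(\<Sum>v\<in>V. h v * ?y v) = (\<Sum>v\<in>V. h v * y v)" for h :: "nat \<times> nat \<Rightarrow> real"
      by (intro sum.cong) (simp_all only: yV)
    note n = rV(1)[OF c(1)] rV(1)[OF c'(1)]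
    have rcI: "(r, c') \<in> I" using r c' rV by (auto simp: I_def hidden_def)
    have e: "?e c' ?y p = ?e c y (?f p)" if p: "p \<in> {1..m} \<times> {1..n}" for p
    proof -
      have y1: "?y (r, c') = y (r, c)" using rcI fr by simp
      have y2: "?y p = y (?f p)" if "p \<notin> H" using that p by (simp add: I_def hidden_def)
      have h: "?f p \<in> H \<longleftrightarrow> p \<in> H" using fV swap_columns_involution[of c c' p] by (metis UnCI)
      have q: "?f p = (r, c) \<longleftrightarrow> p = (r, c')" using fr swap_columns_involution by metis
      have f1: "fst (?f p) = fst p" by (simp add: swap_columns_def)
      have "A (?f p) = A p" if "p \<in> H" using that fV by simp
      with y1 y2 h q f1 show ?thesis
        unfolding
          ent_reveal[of V r c A "?f p" B H y, OF st(1) n(1) supp(1)[OF n(1)] supp(2)[OF n(1)]]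
          ent_reveal[of V r c' A p B H ?y, OF st(1) n(2) supp(1)[OF n(2)] supp(2)[OF n(2)]]
        by (auto simp only: sumV split: if_split)
    qed
    have s: "(\<Sum>p\<in>S. ?e c' ?y p) = (\<Sum>p\<in>?f ` S. ?e c y p)" if "S \<in> saturating m n k D" for S
    proof -
      have "(\<Sum>p\<in>S. ?e c' ?y p) = (\<Sum>p\<in>S. ?e c y (?f p))"
        using that by (intro sum.cong e) (auto simp: saturating_def assignments_in_def)
      then show ?thesis by (simp add: sum.reindex[OF inj_swap_columns] o_def)
    qed
    have sat: "?f ` S \<in> saturating m n k D" if "S \<in> saturating m n k D" for S
      using that c c' st(4) by (intro swap_columns_saturating) auto
    have "(\<lambda>S. \<Sum>p\<in>S. ?e c' ?y p) ` saturating m n k D = (\<lambda>S. \<Sum>p\<in>S. ?e c y p) ` saturating m n k D"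
    proof (intro antisym subsetI)
      fix z assume "z \<in> (\<lambda>S. \<Sum>p\<in>S. ?e c' ?y p) ` saturating m n k D"
      then show "z \<in> (\<lambda>S. \<Sum>p\<in>S. ?e c y p) ` saturating m n k D" using s sat by auto
    next
      fix z assume "z \<in> (\<lambda>S. \<Sum>p\<in>S. ?e c y p) ` saturating m n k D"
      then obtain S where S: "S \<in> saturating m n k D" "z = (\<Sum>p\<in>S. ?e c y p)" by auto
      have "?f ` ?f ` S = S" by (simp add: image_image swap_columns_involution)
      then have "z = (\<Sum>p\<in>?f ` S. ?e c' ?y p)" using s[OF sat[OF S(1)]] S(2) by simp
      then show "z \<in> (\<lambda>S. \<Sum>p\<in>S. ?e c' ?y p) ` saturating m n k D" using sat[OF S(1)] by blast
    qed
    then show ?thesis unfolding F_def sat_cost_def by (simp only:)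
  qed
  have "(\<integral>\<^sup>+y. F c y \<partial>expo_prod I (R c)) = (\<integral>\<^sup>+y. F c' y \<partial>expo_prod I (R c'))"
    using nn_integral_expo_prod_reindex[OF inj_swap_columns fI meas, of "R c"] unfolding F R .
  then show ?thesis
    unfolding sat_mean_def I[OF c] I[OF c'] F_def R_def .
qed

text \<open>Once every row has enough revealed entries, some cheapest assignment lies inside
  \<open>H\<close>. The cost is then a minimum over a set of forms that does not depend on
  \<open>n\<close>, and the hidden variables integrate out.\<close>

lemma (in partial_matrix) sat_mean_all_revealed:
  assumes full: "\<And>r. r \<in> {1..m} \<Longrightarrow> k \<le> card {c. (r, c) \<in> H \<and> c \<notin> D} + card D"
  shows "\<exists>f. rational_from (real k) f \<and> (\<forall>n\<ge>n0. 0 \<le> f (real n) \<and> sat_mean m n k D V \<rho> H A B = ennreal (f (real n)))"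
proof -
  define \<S> where "\<S> = {S \<in> saturating m n0 k D. S \<subseteq> H}"
  define a where "a S v = (\<Sum>p\<in>S. A p v)" for S v
  have fin: "finite \<S>" using finite_saturating by (simp add: \<S>_def)
  have ne: "\<S> \<noteq> {}"
  proof -
    \<comment> \<open>The exchange is used with all costs 0, merely to obtain an assignment inside
      \<open>H\<close>.\<close>
    obtain S where S: "S \<in> saturating m n0 k D" using saturating_nonempty by auto
    show ?thesis
      using restrict_to_revealed[OF H_subset D_revealed order_refl full _ S, of "\<lambda>_. 0"]
      by (auto simp: \<S>_def)
  qed
  have cost: "sat_cost m n k D V H A B y = min_form V \<S> a y"
    if n: "n \<ge> n0" and y: "\<forall>i\<in>V \<union> hidden m n H. 0 \<le> y i" for n y
  proof -
    let ?g = "\<lambda>S. \<Sum>p\<in>S. ent V H A B y p"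
    have "Min (?g ` saturating m n k D) = Min (?g ` \<S>)"
    proof (rule Min_image_dominated[OF finite_saturating _ ne])
      show "\<S> \<subseteq> saturating m n k D" using saturating_mono[OF n] by (auto simp: \<S>_def)
      fix S assume S: "S \<in> saturating m n k D"
      have "\<exists>S'\<in>saturating m n0 k D. S' \<subseteq> H \<and> ?g S' \<le> ?g S"
      proof (rule restrict_to_revealed[OF H_subset D_revealed n full _ S])
        fix r c c' assume rc: "(r, c) \<in> H" "c \<notin> D" "(r, c') \<in> {1..m} \<times> {1..n} - H"
        have "(\<Sum>v\<in>V. A (r, c) v * y v) \<le> (\<Sum>v\<in>V. B r v * y v)"
          using A_le_B[OF rc(1,2)] y by (intro sum_mono mult_right_mono) auto
        moreover have "0 \<le> y (r, c')" using y rc(3) by (auto simp: hidden_def)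
        ultimately show "ent V H A B y (r, c) \<le> ent V H A B y (r, c')"
          using rc by (simp add: ent_def)
      qed
      then show "\<exists>S'\<in>\<S>. ?g S' \<le> ?g S" by (auto simp: \<S>_def)
    qed
    also have "?g ` \<S> = (\<lambda>S. \<Sum>v\<in>V. a S v * y v) ` \<S>"
    proof (rule image_cong[OF refl])
      fix S assume "S \<in> \<S>"
      then have "?g S = (\<Sum>p\<in>S. \<Sum>v\<in>V. A p v * y v)"
        by (intro sum.cong) (auto simp: ent_def \<S>_def)
      also have "\<dots> = (\<Sum>v\<in>V. a S v * y v)"
        unfolding a_def sum_distrib_right by (rule sum.swap)
      finally show "?g S = (\<Sum>v\<in>V. a S v * y v)" .
    qed
    finally show ?thesis by (simp add: sat_cost_def min_form_def)
  qed
  have "rational_mean (real k) V \<S> \<rho> a"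
    using fin ne finite_V rate_pos rate_rational
    by (rule rational_mean_min_form) (auto simp: a_def A_nonneg intro: sum_nonneg)
  then obtain f where f: "rational_from (real k) f"
    "\<And>x. x \<ge> real k \<Longrightarrow> 0 \<le> f x \<and> (\<integral>\<^sup>+y. ennreal (min_form V \<S> a y) \<partial>expo_prod V (\<lambda>v. \<rho> v x)) = ennreal (f x)"
    unfolding rational_mean_def by blast
  have "sat_mean m n k D V \<rho> H A B = ennreal (f (real n))" if n: "n \<ge> n0" for n
  proof -
    let ?R = "\<lambda>v. if v \<in> V then \<rho> v (real n) else 1"
    have "sat_mean m n k D V \<rho> H A B =
        (\<integral>\<^sup>+y. ennreal (min_form V \<S> a y) \<partial>expo_prod (V \<union> hidden m n H) ?R)"
      unfolding sat_mean_def
    proof (rule nn_integral_cong_AE)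
      have "finite (V \<union> hidden m n H)" using finite_V finite_hidden by auto
      from AE_expo_prod_nonneg[OF this]
      show "AE y in expo_prod (V \<union> hidden m n H) ?R.
          ennreal (sat_cost m n k D V H A B y) = ennreal (min_form V \<S> a y)"
        by eventually_elim (simp only: cost[OF n])
    qed
    \<comment> \<open>The restriction to \<open>V\<close> brings the integrand into the shape in
      which reindexing along the identity discards the hidden variables.\<close>
    also have "\<dots> = (\<integral>\<^sup>+y. ennreal (min_form V \<S> a (\<lambda>v\<in>V. y v)) \<partial>expo_prod (V \<union> hidden m n H) ?R)"
    proof (rule nn_integral_cong)
      fix y
      have "(\<lambda>S. \<Sum>v\<in>V. a S v * y v) = (\<lambda>S. \<Sum>v\<in>V. a S v * restrict y V v)"
        by (intro ext sum.cong) auto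
      then show "ennreal (min_form V \<S> a y) = ennreal (min_form V \<S> a (\<lambda>v\<in>V. y v))"
        unfolding min_form_def by (simp only:)
    qed
    also have "\<dots> = (\<integral>\<^sup>+y. ennreal (min_form V \<S> a y) \<partial>expo_prod V ?R)"
      using nn_integral_expo_prod_reindex[of "\<lambda>v. v" V "V \<union> hidden m n H" "\<lambda>y. ennreal (min_form V \<S> a y)" ?R]
        measurable_min_form[of \<S> V V a, OF fin order_refl] by simp
    also have "expo_prod V ?R = expo_prod V (\<lambda>v. \<rho> v (real n))"
      by (rule expo_prod_cong) simp
    also have "(\<integral>\<^sup>+y. ennreal (min_form V \<S> a y) \<partial>expo_prod V (\<lambda>v. \<rho> v (real n))) = ennreal (f (real n))"
      using f(2) n k_le by simp
    finally show ?thesis .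
  qed
  then show ?thesis using f k_le by (intro exI[of _ f]) auto
qed

text \<open>All of \<open>D\<close> is revealed, so \<open>j\<close> counts the revealed positions
  in row \<open>r\<close>. The other \<open>n - j\<close> race with rate 1 each: every one wins with
  probability \<open>1 / (n - j)\<close>, and the winning time has rate
  \<open>n - j\<close>.\<close>

lemma (in partial_matrix) sat_mean_race:
  assumes n: "n \<ge> n0" and r: "r \<in> {1..m}"
    and j: "j = card D + card {c. (r, c) \<in> H \<and> c \<notin> D}" "j < n"
  shows "sat_mean m n k D V \<rho> H A B =
    (\<Sum>c\<in>{c \<in> {1..n}. (r, c) \<notin> H}. ennreal (1 / (real n - real j)) *
       sat_mean m n k D (insert (r, c) V) (\<rho>((r, c) := \<lambda>x. x - real j)) (insert (r, c) H)
         (A((r, c) := (B r)((r, c) := 1))) (B(r := (B r)((r, c) := 1))))"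
proof -
  let ?C = "{c \<in> {1..n}. (r, c) \<notin> H}"
  let ?Q = "{(r, c) |c. (r, c) \<in> hidden m n H}"
  define I where "I = V \<union> hidden m n H"
  define R where "R v = (if v \<in> V then \<rho> v (real n) else 1)" for v
  have Q: "?Q = Pair r ` ?C" using r by (auto simp: hidden_def)
  have fI: "finite I" using finite_V finite_hidden by (simp add: I_def)
  have Qh: "?Q \<subseteq> hidden m n H" by auto
  have QI: "?Q \<subseteq> I" using Qh by (auto simp: I_def)
  have hV: "v \<notin> V" if "v \<in> hidden m n H" for v using that V_subset by (auto simp: hidden_def)
  have RQ: "R v = 1" if "v \<in> ?Q" for v using that hV Qh by (auto simp: R_def)
  have "card ?C = n - j"
  proof -
    let ?K = "{c. (r, c) \<in> H \<and> c \<notin> D}"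
    have K: "?K \<subseteq> {1..n}" "D \<subseteq> {1..n}" using H_subset D_subset n by fastforce+
    have "?C = {1..n} - (D \<union> ?K)" using D_revealed r by blast
    moreover have "card (D \<union> ?K) = j"
      unfolding j(1) using K by (intro card_Un_disjoint) (auto intro: finite_subset)
    moreover have "finite (D \<union> ?K)" using K by (auto intro: finite_subset)
    ultimately show ?thesis using K by (simp add: card_Diff_subset)
  qed
  then have cQ: "real (card ?Q) = real n - real j" using j(2) unfolding Q by (simp add: card_image inj_on_def)
  then have "card ?Q \<noteq> 0" using j(2) by linarith
  then have ne: "?Q \<noteq> {}" by (metis card.empty)
  have sumR: "(\<Sum>v\<in>?Q. R v) = real n - real j" using RQ cQ by simp
  have "sat_mean m n k D V \<rho> H A B = (\<integral>\<^sup>+y. ennreal (sat_cost m n k D V H A B y) \<partial>expo_prod I R)"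
    unfolding sat_mean_def I_def R_def ..
  also have "\<dots> = (\<Sum>q\<in>?Q. ennreal (R q / (\<Sum>v\<in>?Q. R v)) *
      (\<integral>\<^sup>+y. ennreal (sat_cost m n k D V H A B (race_map ?Q q y)) \<partial>expo_prod I (R(q := \<Sum>v\<in>?Q. R v))))"
    by (rule nn_integral_expo_prod_race[OF fI QI ne])
      (use RQ in simp, rule measurable_sat_cost, simp add: I_def)
  also have "\<dots> = (\<Sum>q\<in>?Q. ennreal (1 / (real n - real j)) *
      (\<integral>\<^sup>+y. ennreal (sat_cost m n k D V H A B (race_map ?Q q y)) \<partial>expo_prod I (R(q := real n - real j))))"
    unfolding sumR by (intro sum.cong refl) (simp only: RQ)
  also have "\<dots> = (\<Sum>c\<in>?C. ennreal (1 / (real n - real j)) *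
      (\<integral>\<^sup>+y. ennreal (sat_cost m n k D V H A B (race_map ?Q (r, c) y)) \<partial>expo_prod I (R((r, c) := real n - real j))))"
    unfolding Q by (subst sum.reindex) (auto simp: inj_on_def)
  also have "\<dots> = (\<Sum>c\<in>?C. ennreal (1 / (real n - real j)) *
       sat_mean m n k D (insert (r, c) V) (\<rho>((r, c) := \<lambda>x. x - real j)) (insert (r, c) H)
         (A((r, c) := (B r)((r, c) := 1))) (B(r := (B r)((r, c) := 1))))"
  proof (rule sum.cong[OF refl])
    fix c assume c: "c \<in> ?C"
    then have rc: "(r, c) \<in> hidden m n H" using r by (auto simp: hidden_def)
    have "insert (r, c) V \<union> hidden m n (insert (r, c) H) = I" using rc by (auto simp: I_def hidden_def)
    moreover have "R((r, c) := real n - real j) =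
      (\<lambda>v. if v \<in> insert (r, c) V then (\<rho>((r, c) := \<lambda>x. x - real j)) v (real n) else 1)"
      by (auto simp: R_def)
    ultimately show "ennreal (1 / (real n - real j)) *
      (\<integral>\<^sup>+y. ennreal (sat_cost m n k D V H A B (race_map ?Q (r, c) y)) \<partial>expo_prod I (R((r, c) := real n - real j))) =
      ennreal (1 / (real n - real j)) *
       sat_mean m n k D (insert (r, c) V) (\<rho>((r, c) := \<lambda>x. x - real j)) (insert (r, c) H)
         (A((r, c) := (B r)((r, c) := 1))) (B(r := (B r)((r, c) := 1)))"
      unfolding sat_mean_def by (simp only: sat_cost_reveal[OF rc])
  qed
  finally show ?thesis .
qed

text \<open>The induction measure is the number of entries still to be revealed; truncated
  subtraction makes finished rows count 0. \<open>n0\<close> is generalized because revealing an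
  entry in column \<open>Suc n0\<close> makes that column part of the fixed block.\<close>

theorem sat_mean_rational:
  assumes "partial_matrix k m n0 D V \<rho> H A B"
  shows "\<exists>f. rational_from (real k) f \<and> (\<forall>n\<ge>n0. 0 \<le> f (real n) \<and> sat_mean m n k D V \<rho> H A B = ennreal (f (real n)))"
  using assms
proof (induction "\<Sum>r=1..m. k - (card D + card {c. (r, c) \<in> H \<and> c \<notin> D})"
    arbitrary: n0 V \<rho> H A B rule: less_induct)
  case less
  interpret partial_matrix k m n0 D V \<rho> H A B by fact
  let ?j = "\<lambda>r. card D + card {c. (r, c) \<in> H \<and> c \<notin> D}"
  show ?case
  proof (cases "\<forall>r\<in>{1..m}. k \<le> ?j r")
    case True
    then show ?thesis by (intro sat_mean_all_revealed) (simp add: add.commute)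
  next
    case False
    then obtain r where r: "r \<in> {1..m}" and jk: "?j r < k" by (auto simp: not_le)
    define j where "j = ?j r"
    let ?g = "\<lambda>x. x - real j"
    let ?P = "\<lambda>n c. sat_mean m n k D (insert (r, c) V) (\<rho>((r, c) := ?g)) (insert (r, c) H)
         (A((r, c) := (B r)((r, c) := 1))) (B(r := (B r)((r, c) := 1)))"
    \<comment> \<open>Here the bound on the poles is secured: row \<open>r\<close> is unfinished, so
      the zero \<open>j\<close> of the new rate lies below \<open>k\<close>.\<close>
    have g: "rational_from (real k) ?g" "\<And>x. x \<ge> real k \<Longrightarrow> 0 < ?g x"
      using jk by (auto simp: j_def intro: rational_from_ident_diff)
    have IH: "\<exists>f. rational_from (real k) f \<and> (\<forall>n\<ge>n1. 0 \<le> f (real n) \<and> ?P n c = ennreal (f (real n)))"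
      if n1: "n0 \<le> n1" and rc: "(r, c) \<in> hidden m n1 H" for n1 c
    proof (rule less.hyps)
      show "partial_matrix k m n1 D (insert (r, c) V) (\<rho>((r, c) := ?g)) (insert (r, c) H)
         (A((r, c) := (B r)((r, c) := 1))) (B(r := (B r)((r, c) := 1)))"
        by (rule partial_matrix_reveal[OF rc n1 g])
      let ?K = "\<lambda>H i. {c. (i, c) \<in> H \<and> c \<notin> D}"
      have fK: "finite (?K H i)" for i
        by (rule finite_subset[of _ "{1..n0}"]) (use H_subset in auto)
      have rcH: "(r, c) \<notin> H" using rc by (simp add: hidden_def)
      then have cD: "c \<notin> D" using D_revealed r by blast
      have "?K (insert (r, c) H) r = insert c (?K H r)" using cD by auto
      then have Kr: "card (?K (insert (r, c) H) r) = Suc (card (?K H r))" using fK rcH by simp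
      have Ki: "?K (insert (r, c) H) i = ?K H i" if "i \<noteq> r" for i using that by auto
      show "(\<Sum>i=1..m. k - (card D + card (?K (insert (r, c) H) i))) < (\<Sum>i=1..m. k - (card D + card (?K H i)))"
      proof (rule sum_strict_mono_ex1)
        show "\<forall>i\<in>{1..m}. k - (card D + card (?K (insert (r, c) H) i)) \<le> k - (card D + card (?K H i))"
        proof
          fix i
          show "k - (card D + card (?K (insert (r, c) H) i)) \<le> k - (card D + card (?K H i))"
            using Kr Ki by (cases "i = r") simp_all
        qed
        show "\<exists>i\<in>{1..m}. k - (card D + card (?K (insert (r, c) H) i)) < k - (card D + card (?K H i))"
          using r Kr jk by (intro bexI[of _ r]) auto
      qed simp
    qed
    let ?O = "{c \<in> {1..n0}. (r, c) \<notin> H}"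
    have "\<forall>c\<in>?O. \<exists>f. rational_from (real k) f \<and> (\<forall>n\<ge>n0. 0 \<le> f (real n) \<and> ?P n c = ennreal (f (real n)))"
      using r by (intro ballI IH) (auto simp: hidden_def)
    from bchoice[OF this] obtain f where f: "\<And>c. c \<in> ?O \<Longrightarrow> rational_from (real k) (f c)"
      "\<And>c n. c \<in> ?O \<Longrightarrow> n \<ge> n0 \<Longrightarrow> 0 \<le> f c (real n) \<and> ?P n c = ennreal (f c (real n))"
      by blast
    \<comment> \<open>Column \<open>Suc n0\<close> represents all \<open>n - n0\<close> columns
      beyond the block, whence the factor \<open>x - real n0\<close> in \<open>F\<close>.\<close>
    have new: "(r, Suc n0) \<in> hidden m (Suc n0) H" using r H_subset by (auto simp: hidden_def)
    obtain h where h: "rational_from (real k) h"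
      "\<And>n. n \<ge> Suc n0 \<Longrightarrow> 0 \<le> h (real n) \<and> ?P n (Suc n0) = ennreal (h (real n))"
      using IH[OF _ new] by auto
    define F where "F x = ((\<Sum>c\<in>?O. f c x) + (x - real n0) * h x) / (x - real j)" for x
    have "rational_from (real k) F"
      unfolding F_def using f(1) h(1) g
      by (intro rational_from_divide rational_from_add rational_from_sum rational_from_mult rational_from_ident_diff) auto
    moreover have "0 \<le> F (real n) \<and> sat_mean m n k D V \<rho> H A B = ennreal (F (real n))" if n: "n \<ge> n0" for n
    proof -
      let ?L = "real n - real j"
      have jn: "j < n" using jk n k_le by (simp add: j_def)
      then have L: "0 < ?L" by simp
      let ?N = "{n0<..n}"
      have C: "{c \<in> {1..n}. (r, c) \<notin> H} = ?O \<union> ?N" using n H_subset by auto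
      have PO: "?P n c = ennreal (f c (real n))" if "c \<in> ?O" for c using f(2)[OF that n] by blast
      have PN: "?P n c = ennreal (h (real n))" if "c \<in> ?N" for c
      proof -
        have "?P n c = ?P n (Suc n0)" using that by (intro sat_mean_reveal_swap r) auto
        then show ?thesis using h(2)[of n] that by auto
      qed
      have sO: "0 \<le> (\<Sum>c\<in>?O. f c (real n))" using f(2) n by (intro sum_nonneg) blast
      \<comment> \<open>For \<open>n = n0\<close> there is no column \<open>Suc n0\<close> and
        nothing is known about \<open>h (real n)\<close>, but its factor is then 0.\<close>
      have sN: "0 \<le> (real n - real n0) * h (real n)"
        using h(2)[of n] n by (cases "n = n0") auto
      have e: "(\<Sum>c\<in>?N. ennreal (h (real n))) = ennreal ((real n - real n0) * h (real n))"
      proof (cases "n = n0")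
        case False
        then have "0 \<le> h (real n)" using h(2)[of n] n by auto
        then have "(\<Sum>c\<in>?N. ennreal (h (real n))) = ennreal (\<Sum>c\<in>?N. h (real n))"
          by (intro sum_ennreal) auto
        then show ?thesis using n by (simp add: of_nat_diff)
      qed simp
      have "sat_mean m n k D V \<rho> H A B = (\<Sum>c\<in>?O \<union> ?N. ennreal (1 / ?L) * ?P n c)"
        using sat_mean_race[OF n r j_def jn] unfolding C .
      also have "\<dots> = (\<Sum>c\<in>?O. ennreal (1 / ?L) * ?P n c) + (\<Sum>c\<in>?N. ennreal (1 / ?L) * ?P n c)"
        by (rule sum.union_disjoint) auto
      also have "(\<Sum>c\<in>?O. ennreal (1 / ?L) * ?P n c) = ennreal (1 / ?L) * (\<Sum>c\<in>?O. ennreal (f c (real n)))"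
        unfolding sum_distrib_left by (intro sum.cong refl) (simp only: PO)
      also have "(\<Sum>c\<in>?O. ennreal (f c (real n))) = ennreal (\<Sum>c\<in>?O. f c (real n))"
        using f(2) n by (intro sum_ennreal) blast
      also have "(\<Sum>c\<in>?N. ennreal (1 / ?L) * ?P n c) = ennreal (1 / ?L) * ennreal ((real n - real n0) * h (real n))"
        unfolding e[symmetric] sum_distrib_left by (intro sum.cong refl) (simp only: PN)
      also have "ennreal (1 / ?L) * ennreal (\<Sum>c\<in>?O. f c (real n)) +
         ennreal (1 / ?L) * ennreal ((real n - real n0) * h (real n)) =
         ennreal (1 / ?L) * ennreal ((\<Sum>c\<in>?O. f c (real n)) + (real n - real n0) * h (real n))"
        using sO sN by (simp only: ennreal_plus distrib_left)
      also have "\<dots> = ennreal (F (real n))"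
        unfolding F_def using L sO sN by (subst ennreal_mult[symmetric]) auto
      finally have "sat_mean m n k D V \<rho> H A B = ennreal (F (real n))" .
      moreover have "0 \<le> F (real n)" unfolding F_def using L sO sN by simp
      ultimately show ?thesis by simp
    qed
    ultimately show ?thesis by blast
  qed
qed

section \<open>Well-behaved sequences\<close>

lemma exponential_rapD:
  assumes "exponential_rap R"
  shows "prob_space (prspace R)"
    and "asg_size R \<le> num_rows R" "asg_size R \<le> num_cols R"
    and "prob_space.indep_vars (prspace R) (\<lambda>_. borel) (var R) {1..num_vars R}"
    and "\<And>i. i \<in> {1..num_vars R} \<Longrightarrow> 0 < intensity R i"
    and "\<And>i. i \<in> {1..num_vars R} \<Longrightarrow>
      distributed (prspace R) lborel (var R i) (exponential_density (intensity R i))"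
    and "\<And>p i. p \<in> positions R \<Longrightarrow> 0 \<le> coef R p i"
    and "\<And>p i. p \<in> positions R \<Longrightarrow> i \<notin> {1..num_vars R} \<Longrightarrow> coef R p i = 0"
proof -
  show "0 \<le> coef R p i" if "p \<in> positions R" for p i
    using assms that unfolding exponential_rap_def by (cases "i \<in> {1..num_vars R}") auto
qed (use assms in \<open>auto simp: exponential_rap_def\<close>)

lemma measurable_var:
  assumes "exponential_rap R" "i \<in> {1..num_vars R}"
  shows "var R i \<in> borel_measurable (prspace R)"
  using distributed_measurable[OF exponential_rapD(6)[OF assms]] by simp

lemma distr_var:
  assumes "exponential_rap R" "i \<in> {1..num_vars R}"
  shows "distr (prspace R) borel (var R i) = expo (intensity R i)"
proof -
  have "distr (prspace R) borel (var R i) = distr (prspace R) lborel (var R i)"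
    by (rule distr_cong) auto
  also have "\<dots> = density lborel (\<lambda>x. ennreal (exponential_density (intensity R i) x))"
    by (rule distributed_distr_eq_density[OF exponential_rapD(6)[OF assms]])
  finally show ?thesis using exponential_rapD(5)[OF assms] by (simp add: expo_def)
qed

lemma AE_var_nonneg:
  assumes "exponential_rap R"
  shows "AE \<omega> in prspace R. \<forall>i\<in>{1..num_vars R}. 0 \<le> var R i \<omega>"
proof (rule AE_finite_allI)
  fix i assume i: "i \<in> {1..num_vars R}"
  have "AE x in distr (prspace R) borel (var R i). 0 \<le> x"
    unfolding distr_var[OF assms i] by (rule AE_expo_nonneg)
  then show "AE \<omega> in prspace R. 0 \<le> var R i \<omega>"
    by (rule AE_distrD[OF measurable_var[OF assms i]])
qed simp

lemma distr_vars:
  fixes R :: "'a rap"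
  defines "I \<equiv> {1..num_vars R}"
  assumes R: "exponential_rap R"
  shows "distr (prspace R) (Pi\<^sub>M I (\<lambda>_. borel)) (\<lambda>\<omega>. \<lambda>i\<in>I. var R i \<omega>) = expo_prod I (intensity R)"
\<comment> \<open>Without variables both measures are the point mass at the only function on the
  empty set; this case is computed directly.\<close>
proof (cases "I = {}")
  case True
  interpret prob_space "prspace R" by (rule exponential_rapD(1)[OF R])
  show ?thesis
  proof (rule measure_eqI)
    fix X assume "X \<in> sets (distr (prspace R) (Pi\<^sub>M I (\<lambda>_. borel)) (\<lambda>\<omega>. \<lambda>i\<in>I. var R i \<omega>))"
    then have X: "X = {} \<or> X = {\<lambda>_. undefined}" using True by (auto simp: sets_PiM_empty)
    have "emeasure (distr (prspace R) (Pi\<^sub>M {} (\<lambda>_. borel)) (\<lambda>\<omega>. \<lambda>i\<in>{}. var R i \<omega>)) {\<lambda>_. undefined} = 1"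
      by (subst emeasure_distr) (auto simp: space_PiM sets_PiM_empty vimage_def restrict_def emeasure_space_1)
    moreover have "emeasure (expo_prod {} (intensity R)) {\<lambda>_. undefined} = 1"
      unfolding expo_prod_def by (simp add: PiM_empty)
    ultimately show "emeasure (distr (prspace R) (Pi\<^sub>M I (\<lambda>_. borel)) (\<lambda>\<omega>. \<lambda>i\<in>I. var R i \<omega>)) X =
      emeasure (expo_prod I (intensity R)) X"
      using X unfolding True by auto
  qed simp
next
  case False
  interpret prob_space "prspace R" by (rule exponential_rapD(1)[OF R])
  have "indep_vars (\<lambda>_. borel) (var R) I"
    using exponential_rapD(4)[OF R] by (simp add: I_def)
  then have "distr (prspace R) (Pi\<^sub>M I (\<lambda>_. borel)) (\<lambda>\<omega>. \<lambda>i\<in>I. var R i \<omega>) =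
    (\<Pi>\<^sub>M i\<in>I. distr (prspace R) borel (var R i))"
    using measurable_var[OF R] by (subst (asm) indep_vars_iff_distr_eq_PiM'[OF False]) (auto simp: I_def)
  also have "\<dots> = expo_prod I (intensity R)"
    unfolding expo_prod_def by (intro PiM_cong refl distr_var[OF R]) (simp add: I_def)
  finally show ?thesis .
qed

text \<open>\<open>\<phi>\<close> selects and renames the variables on which the integrand depends.
  Its injectivity preserves independence, and the remaining variables integrate out.\<close>

lemma nn_integral_vars:
  assumes R: "exponential_rap R" and \<phi>: "inj_on \<phi> I" "\<phi> ` I \<subseteq> {1..num_vars R}"
    and G: "G \<in> borel_measurable (Pi\<^sub>M I (\<lambda>_. borel))"
  shows "(\<integral>\<^sup>+\<omega>. G (\<lambda>v\<in>I. var R (\<phi> v) \<omega>) \<partial>prspace R) = (\<integral>\<^sup>+x. G x \<partial>expo_prod I (\<lambda>v. intensity R (\<phi> v)))"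
proof -
  let ?N = "{1..num_vars R}"
  have m: "(\<lambda>\<omega>. \<lambda>i\<in>?N. var R i \<omega>) \<in> prspace R \<rightarrow>\<^sub>M Pi\<^sub>M ?N (\<lambda>_. borel)"
    by (intro measurable_restrict measurable_var[OF R])
  have m2: "(\<lambda>x. \<lambda>v\<in>I. x (\<phi> v)) \<in> Pi\<^sub>M ?N (\<lambda>_. borel :: real measure) \<rightarrow>\<^sub>M Pi\<^sub>M I (\<lambda>_. borel :: real measure)"
    using \<phi>(2) by (intro measurable_restrict measurable_component_singleton) auto
  have "(\<lambda>v\<in>I. var R (\<phi> v) \<omega>) = (\<lambda>v\<in>I. (\<lambda>i\<in>?N. var R i \<omega>) (\<phi> v))" for \<omega>
    using \<phi>(2) by (intro restrict_ext) (auto simp: image_subset_iff)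
  then have "(\<integral>\<^sup>+\<omega>. G (\<lambda>v\<in>I. var R (\<phi> v) \<omega>) \<partial>prspace R) =
    (\<integral>\<^sup>+\<omega>. G (\<lambda>v\<in>I. (\<lambda>i\<in>?N. var R i \<omega>) (\<phi> v)) \<partial>prspace R)"
    by (simp only:)
  also have "\<dots> = (\<integral>\<^sup>+x. G (\<lambda>v\<in>I. x (\<phi> v)) \<partial>expo_prod ?N (intensity R))"
    unfolding distr_vars[OF R, symmetric] using measurable_compose[OF m2 G] by (subst nn_integral_distr[OF m]) simp_all
  also have "\<dots> = (\<integral>\<^sup>+x. G x \<partial>expo_prod I (\<lambda>v. intensity R (\<phi> v)))"
    by (rule nn_integral_expo_prod_reindex[OF \<phi> G])
  finally show ?thesis .
qed

lemma assignments_eq: "assignments R = assignments_in (num_rows R) (num_cols R) (asg_size R)"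
  by (simp add: assignments_def assignments_in_def positions_def)

lemma assignments_in_nonempty:
  assumes "k \<le> m" "k \<le> n"
  shows "assignments_in m n k \<noteq> {}"
proof -
  have "(\<lambda>i. (i, i)) ` {1..k} \<in> assignments_in m n k"
    using assms by (auto simp: assignments_in_def card_image inj_on_def)
  then show ?thesis by blast
qed

lemma entry_nonneg:
  assumes "exponential_rap R" "p \<in> positions R" "\<forall>i\<in>{1..num_vars R}. 0 \<le> var R i \<omega>"
  shows "0 \<le> entry R p \<omega>"
  unfolding entry_def using assms(3) exponential_rapD(7)[OF assms(1,2)]
  by (intro sum_nonneg mult_nonneg_nonneg) auto

lemma measurable_min_cost:
  assumes "exponential_rap R"
  shows "min_cost R \<in> borel_measurable (prspace R)"
proof -
  have "(\<lambda>\<omega>. \<Sum>p\<in>S. entry R p \<omega>) \<in> borel_measurable (prspace R)" for S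
    unfolding entry_def using measurable_var[OF assms]
    by (intro borel_measurable_sum borel_measurable_times) auto
  then show ?thesis
    unfolding min_cost_def assignments_eq using finite_assignments_in by (intro borel_measurable_Min) auto
qed

lemma min_cost_nonneg:
  assumes "exponential_rap R" "\<forall>i\<in>{1..num_vars R}. 0 \<le> var R i \<omega>"
  shows "0 \<le> min_cost R \<omega>"
proof -
  have "0 \<le> (\<Sum>p\<in>S. entry R p \<omega>)" if "S \<in> assignments R" for S
    using that by (intro sum_nonneg entry_nonneg assms) (auto simp: assignments_def)
  moreover have "assignments R \<noteq> {}" "finite (assignments R)"
    unfolding assignments_eq using assignments_in_nonempty exponential_rapD(2,3)[OF assms(1)] finite_assignments_in by auto
  ultimately show ?thesis unfolding min_cost_def by (subst Min_ge_iff) auto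
qed

lemma expected_min_cost_eqI:
  assumes "exponential_rap R" "(\<integral>\<^sup>+\<omega>. ennreal (min_cost R \<omega>) \<partial>prspace R) = ennreal y" "0 \<le> y"
  shows "expected_min_cost R = y"
proof -
  have "AE \<omega> in prspace R. 0 \<le> min_cost R \<omega>"
    using AE_var_nonneg[OF assms(1)] by eventually_elim (rule min_cost_nonneg[OF assms(1)])
  then show ?thesis unfolding expected_min_cost_def
    using integral_eq_nn_integral[OF measurable_min_cost[OF assms(1)]] assms(2,3) by simp
qed

lemma entry_standard:
  assumes "standard_var R i" "occurs_at R i p"
  shows "entry R p \<omega> = var R i \<omega>"
proof -
  have "coef R p j = (if j = i then 1 else 0)" if "j \<in> {1..num_vars R}" for j
    using assms that unfolding standard_var_def by blast
  then have "entry R p \<omega> = (\<Sum>j=1..num_vars R. if j = i then var R j \<omega> else 0)"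
    unfolding entry_def by (intro sum.cong) auto
  then show ?thesis using assms by (simp add: standard_var_def)
qed

section \<open>The common zeros of a sequence and its expected costs\<close>

locale well_behaved_sequence =
  fixes P :: "nat \<Rightarrow> 'a rap" and k m n0 :: nat
  assumes well_behaved: "well_behaved k m n0 P"
begin

lemma rap: "n0 \<le> n \<Longrightarrow> exponential_rap (P n)"
  and dims: "n0 \<le> n \<Longrightarrow> num_rows (P n) = m" "n0 \<le> n \<Longrightarrow> num_cols (P n) = n" "n0 \<le> n \<Longrightarrow> asg_size (P n) = k"
  and coef_eq: "n0 \<le> n \<Longrightarrow> p \<in> {1..m} \<times> {1..n0} \<Longrightarrow> coef (P n) p i = coef (P n0) p i"
  and standard_beyond: "n0 \<le> n \<Longrightarrow> p \<in> {1..m} \<times> {n0<..n} \<Longrightarrow> standard_pos (P n) p"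
  using well_behaved unfolding well_behaved_def rap_sequence_def by blast+

lemma polynomial_intensity:
  assumes "p \<in> {1..m} \<times> {1..n0}" "occurs_at (P n0) i p"
  shows "\<exists>f. k_positive k f \<and> (\<forall>n\<ge>n0. intensity (P n) i = poly f (real n))"
  using well_behaved assms unfolding well_behaved_def by blast

lemma standard_outside:
  assumes "n0 \<le> n" "(r, c) \<in> {1..m} \<times> {1..n}" "\<not> is_zero (P n) (r, c)" "c \<notin> column_maximal_columns (P n)"
  shows "standard_pos (P n) (r, c)"
proof -
  have "\<forall>r c. (r, c) \<in> positions (P n) \<and> \<not> is_zero (P n) (r, c) \<and> \<not> standard_pos (P n) (r, c) \<longrightarrow>
      c \<in> column_maximal_columns (P n)"
    using well_behaved assms(1) unfolding well_behaved_def by blast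
  moreover have "(r, c) \<in> positions (P n)" using assms(2) dims(1,2)[OF assms(1)] by (simp add: positions_def)
  ultimately show ?thesis using assms(3,4) by blast
qed

lemma positions_eq: "n0 \<le> n \<Longrightarrow> positions (P n) = {1..m} \<times> {1..n}"
  by (simp add: positions_def dims)

lemma k_le: "k \<le> m" "k \<le> n0"
  using exponential_rapD(2,3)[OF rap[OF order_refl]] dims by auto

definition zeros :: "(nat \<times> nat) set" where
  "zeros = {p \<in> {1..m} \<times> {1..n0}. \<forall>i. coef (P n0) p i = 0}"

lemma zeros_subset: "zeros \<subseteq> {1..m} \<times> {1..n0}"
  by (auto simp: zeros_def)

text \<open>A standard entry is not a zero, so there are none beyond column \<open>n0\<close>, and
  within the first \<open>n0\<close> columns the coefficients do not depend on
  \<open>n\<close>.\<close>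

lemma is_zero_iff:
  assumes n: "n0 \<le> n"
  shows "is_zero (P n) p \<longleftrightarrow> p \<in> zeros"
proof
  assume z: "is_zero (P n) p"
  then have pos: "p \<in> {1..m} \<times> {1..n}" using positions_eq[OF n] by (simp add: is_zero_def)
  have c: "coef (P n) p i = 0" for i
    using z exponential_rapD(8)[OF rap[OF n]] unfolding is_zero_def by blast
  then have "\<not> standard_pos (P n) p" by (simp add: standard_pos_def occurs_at_def)
  then have "p \<notin> {1..m} \<times> {n0<..n}" using standard_beyond[OF n] by blast
  then have "p \<in> {1..m} \<times> {1..n0}" using pos by auto
  with c show "p \<in> zeros" using coef_eq[OF n] by (simp add: zeros_def)
next
  assume "p \<in> zeros"
  moreover from this have "p \<in> {1..m} \<times> {1..n0}" by (simp add: zeros_def)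
  moreover from this have "p \<in> positions (P n)" unfolding positions_eq[OF n] using n by auto
  ultimately show "is_zero (P n) p" using coef_eq[OF n] by (simp add: is_zero_def zeros_def)
qed

lemma entry_zero: "n0 \<le> n \<Longrightarrow> p \<in> zeros \<Longrightarrow> entry (P n) p \<omega> = 0"
  using is_zero_iff[of n p] by (simp add: is_zero_def entry_def)

text \<open>A smallest cover \<open>RC\<close> is compared with both sides: \<open>M\<close> has at
  least as many edges as \<open>RC\<close> has lines, and no optimal cover of any \<open>P n\<close>
  has more lines than \<open>RC\<close>. Hence each optimal cover is tight for
  \<open>M\<close>.\<close>

lemma maximum_zero_matching:
  "\<exists>M\<subseteq>zeros. inj_on fst M \<and> inj_on snd M \<and> (\<forall>n\<ge>n0. column_maximal_columns (P n) \<subseteq> snd ` M)"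
proof -
  define cover where "cover RC \<longleftrightarrow> finite (fst RC) \<and> finite (snd RC) \<and> (\<forall>(r, c)\<in>zeros. r \<in> fst RC \<or> c \<in> snd RC)"
    for RC :: "nat set \<times> nat set"
  have fz: "finite zeros" using zeros_subset by (rule finite_subset) simp
  have "cover (fst ` zeros, {})" using fz by (force simp: cover_def)
  then obtain RC where RC: "cover RC"
    "\<And>RC'. cover RC' \<Longrightarrow> card (fst RC) + card (snd RC) \<le> card (fst RC') + card (snd RC')"
    using ex_has_least_nat[of cover _ "\<lambda>RC. card (fst RC) + card (snd RC)"] by blast
  have "card (fst RC) + card (snd RC) \<le> card R + card C"
    if "finite R" "finite C" "\<forall>(r, c)\<in>zeros. r \<in> R \<or> c \<in> C" for R C
    using RC(2)[of "(R, C)"] that by (simp add: cover_def)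
  from matching_of_cover_number[OF fz this]
  obtain M where M: "M \<subseteq> zeros" "inj_on fst M" "inj_on snd M" "card (fst RC) + card (snd RC) \<le> card M"
    by blast
  have "column_maximal_columns (P n) \<subseteq> snd ` M" if n: "n0 \<le> n" for n
  proof
    fix c assume "c \<in> column_maximal_columns (P n)"
    then obtain R C where o: "optimal_zero_cover (P n) R C" and c: "c \<in> C"
      by (auto simp: column_maximal_columns_def)
    \<comment> \<open>\<open>RC\<close> is minimal among all finite covers and might have lines
      outside the matrix; cutting it down to the matrix gives a competitor for
      \<open>zero_cover\<close>.\<close>
    let ?R = "fst RC \<inter> {1..m}" and ?C = "snd RC \<inter> {1..n}"
    have "zero_cover (P n) ?R ?C"
      unfolding zero_cover_def is_zero_iff[OF n] dims(1)[OF n] dims(2)[OF n]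
    proof (intro conjI allI impI)
      fix r c assume z: "(r, c) \<in> zeros"
      then have "r \<in> {1..m}" "c \<in> {1..n}" using zeros_subset n by auto
      moreover have "r \<in> fst RC \<or> c \<in> snd RC" using RC(1) z unfolding cover_def by blast
      ultimately show "r \<in> ?R \<or> c \<in> ?C" by blast
    qed auto
    then have "card R + card C \<le> card ?R + card ?C" using o unfolding optimal_zero_cover_def by blast
    also have "\<dots> \<le> card (fst RC) + card (snd RC)"
      using RC(1) by (intro add_mono card_mono) (auto simp: cover_def)
    finally have le: "card R + card C \<le> card M" using M(4) by simp
    have zc: "R \<subseteq> {1..m}" "C \<subseteq> {1..n}" "\<And>r c. (r, c) \<in> zeros \<Longrightarrow> r \<in> R \<or> c \<in> C"
      using o dims(1,2)[OF n] is_zero_iff[OF n] unfolding optimal_zero_cover_def zero_cover_def by auto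
    have "\<forall>(r, c)\<in>M. r \<in> R \<or> c \<in> C" using zc(3) M(1) by blast
    moreover have "finite R" "finite C" using zc(1,2) by (auto intro: finite_subset)
    ultimately have "C \<subseteq> snd ` M"
      using tight_cover_columns[OF finite_subset[OF M(1) fz] M(3,2)] le by blast
    with c show "c \<in> snd ` M" by blast
  qed
  with M(1-3) show ?thesis by blast
qed

lemma expected_min_cost_zero:
  assumes M: "M \<subseteq> zeros" "inj_on fst M" "inj_on snd M" "k \<le> card M" and n: "n0 \<le> n"
  shows "expected_min_cost (P n) = 0"
proof (rule expected_min_cost_eqI[OF rap[OF n]])
  obtain S where S: "S \<subseteq> M" "card S = k" using M(4) obtain_subset_with_card_n by metis
  have "zeros \<subseteq> {1..m} \<times> {1..n}" using zeros_subset n by fastforce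
  then have SA: "S \<in> assignments (P n)"
    using S M unfolding assignments_eq assignments_in_def dims[OF n] by (auto intro: inj_on_subset)
  have "AE \<omega> in prspace (P n). ennreal (min_cost (P n) \<omega>) = 0"
    using AE_var_nonneg[OF rap[OF n]]
  proof eventually_elim
    case (elim \<omega>)
    have "min_cost (P n) \<omega> \<le> (\<Sum>p\<in>S. entry (P n) p \<omega>)"
      unfolding min_cost_def using SA finite_assignments_in by (intro Min_le) (auto simp: assignments_eq)
    also have "\<dots> = 0" using S M(1) entry_zero[OF n] by (intro sum.neutral) blast
    finally show ?case by (simp add: ennreal_neg)
  qed
  then have "(\<integral>\<^sup>+\<omega>. ennreal (min_cost (P n) \<omega>) \<partial>prspace (P n)) = (\<integral>\<^sup>+\<omega>. 0 \<partial>prspace (P n))"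
    by (rule nn_integral_cong_AE)
  then show "(\<integral>\<^sup>+\<omega>. ennreal (min_cost (P n) \<omega>) \<partial>prspace (P n)) = ennreal 0" by simp
qed simp

text \<open>By the choice of \<open>M\<close>, an entry outside \<open>D\<close> is a zero or
  standard. So \<open>P n\<close> is a partially revealed matrix: the columns of \<open>D\<close>
  and all zeros are revealed, and each hidden entry is a variable of its own.\<close>

lemma expected_min_cost_rational:
  assumes M: "M \<subseteq> zeros" "inj_on fst M" "inj_on snd M" "card M \<le> k"
    and max: "\<And>n. n0 \<le> n \<Longrightarrow> column_maximal_columns (P n) \<subseteq> snd ` M"
  shows "\<exists>f. rational_from (real k) f \<and> (\<forall>n\<ge>n0. expected_min_cost (P n) = f (real n))"
proof -
  define D where "D = snd ` M"
  have DM: "D \<subseteq> {1..n0}" "card D = card M" using M zeros_subset by (auto simp: D_def card_image)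
  define H where "H = {1..m} \<times> D \<union> zeros"
  define J where "J = {i. \<exists>p\<in>{1..m} \<times> D. coef (P n0) p i \<noteq> 0}"
  define V where "V = Pair (0::nat) ` J"
  have Dpos: "{1..m} \<times> D \<subseteq> {1..m} \<times> {1..n0}" using DM by auto
  have Jn: "J \<subseteq> {1..num_vars (P n)}" if n: "n0 \<le> n" for n
  proof
    fix i assume "i \<in> J"
    then obtain p where p: "p \<in> {1..m} \<times> D" "coef (P n0) p i \<noteq> 0" by (auto simp: J_def)
    then have "p \<in> {1..m} \<times> {1..n0}" using Dpos by blast
    then have "coef (P n) p i \<noteq> 0" "p \<in> positions (P n)"
      using p(2) coef_eq[OF n] positions_eq[OF n] n by auto
    then show "i \<in> {1..num_vars (P n)}" using exponential_rapD(8)[OF rap[OF n]] by blast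
  qed
  have occ: "\<exists>p\<in>{1..m} \<times> D. occurs_at (P n) i p" if n: "n0 \<le> n" and i: "i \<in> J" for n i
  proof -
    obtain p where p: "p \<in> {1..m} \<times> D" "coef (P n0) p i \<noteq> 0" using i by (auto simp: J_def)
    then have "p \<in> {1..m} \<times> {1..n0}" using Dpos by blast
    then have "occurs_at (P n) i p"
      using p(2) coef_eq[OF n] positions_eq[OF n] n Jn[OF n] i by (auto simp: occurs_at_def)
    with p(1) show ?thesis by blast
  qed
  have "\<exists>f. k_positive k f \<and> (\<forall>n\<ge>n0. intensity (P n) i = poly f (real n))" if "i \<in> J" for i
    using occ[OF order_refl that] Dpos polynomial_intensity by blast
  then obtain f where f: "\<And>i. i \<in> J \<Longrightarrow> k_positive k (f i)"
    "\<And>i n. i \<in> J \<Longrightarrow> n0 \<le> n \<Longrightarrow> intensity (P n) i = poly (f i) (real n)" by metis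
  define \<rho> where "\<rho> v = poly (f (snd v))" for v :: "nat \<times> nat"
  define A where "A p v = (if p \<in> {1..m} \<times> D \<and> fst v = 0 then of_rat (coef (P n0) p (snd v)) else 0 :: real)"
    for p v :: "nat \<times> nat"
  \<comment> \<open>Nothing has been revealed in increasing order yet: hidden entries are bare
    variables, and the revealed entries outside \<open>D\<close> are zeros, so \<open>A_le_B\<close>
    compares 0 with 0.\<close>
  define B where "B r v = (0::real)" for r :: nat and v :: "nat \<times> nat"
  \<comment> \<open>Again costs 0: only the existence of a saturating assignment is wanted.\<close>
  have "\<exists>S'\<in>saturating m n0 k D. (\<Sum>p\<in>S'. 0) \<le> (\<Sum>p\<in>S. 0::real)" if "S \<in> assignments_in m n0 k" for S
    by (rule saturate_columns[of M]) (use M zeros_subset that DM in \<open>auto simp: D_def\<close>)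
  then have sat: "saturating m n0 k D \<noteq> {}" using assignments_in_nonempty[OF k_le] by blast
  have pm: "partial_matrix k m n0 D V \<rho> H A B"
  proof
    show "finite V" unfolding V_def using Jn[OF order_refl] by (auto intro: finite_subset)
    show "{1..m} \<times> D \<subseteq> H" "H \<subseteq> {1..m} \<times> {1..n0}" using Dpos zeros_subset by (auto simp: H_def)
    show "V \<subseteq> {0} \<times> UNIV \<union> H" by (auto simp: V_def)
    show "rational_from (real k) (\<rho> v)" for v unfolding \<rho>_def by (rule rational_from_poly)
    show "0 < \<rho> v x" if "v \<in> V" "x \<ge> real k" for v x
      using f(1) that by (auto simp: \<rho>_def V_def k_positive_def)
    show "0 \<le> A p v" for p v
      using exponential_rapD(7)[OF rap[OF order_refl], of p "snd v"] positions_eq[OF order_refl] Dpos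
      by (auto simp: A_def)
    show "A p v = 0" if "v \<notin> V" for p v
      using that by (cases v) (auto simp: A_def V_def J_def)
    show "A (r, c) v \<le> B r v" if "c \<notin> D" for r c v using that by (simp add: A_def B_def)
  qed (use DM M(4) k_le sat in \<open>auto simp: B_def\<close>)
  obtain g where g: "rational_from (real k) g"
    "\<And>n. n \<ge> n0 \<Longrightarrow> 0 \<le> g (real n) \<and> sat_mean m n k D V \<rho> H A B = ennreal (g (real n))"
    using sat_mean_rational[OF pm] by blast
  have "expected_min_cost (P n) = g (real n)" if n: "n0 \<le> n" for n
  proof (rule expected_min_cost_eqI[OF rap[OF n]])
    let ?I = "V \<union> hidden m n H"
    have std: "\<exists>i. standard_var (P n) i \<and> occurs_at (P n) i p" if p: "p \<in> hidden m n H" for p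
    proof -
      obtain r c where rc: "p = (r, c)" by (cases p)
      have "(r, c) \<in> {1..m} \<times> {1..n}" "c \<notin> D" "(r, c) \<notin> zeros" using p rc by (auto simp: hidden_def H_def)
      moreover from this have "c \<notin> column_maximal_columns (P n)" using max[OF n] by (auto simp: D_def)
      ultimately have "standard_pos (P n) (r, c)" using standard_outside[OF n] is_zero_iff[OF n] by blast
      then show ?thesis unfolding rc standard_pos_def .
    qed
    then obtain \<sigma> where \<sigma>: "\<And>p. p \<in> hidden m n H \<Longrightarrow> standard_var (P n) (\<sigma> p)"
      "\<And>p. p \<in> hidden m n H \<Longrightarrow> occurs_at (P n) (\<sigma> p) p" by metis
    \<comment> \<open>An index \<open>(0, i)\<close> stands for variable \<open>i\<close>, the index
      of a hidden position for the standard variable at that position.\<close>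
    define \<phi> where "\<phi> v = (if fst v = 0 then snd v else \<sigma> v)" for v
    have \<phi>V: "\<phi> v = snd v" "fst v = 0" "snd v \<in> J" if "v \<in> V" for v using that by (auto simp: \<phi>_def V_def)
    have \<phi>h: "\<phi> v = \<sigma> v" if "v \<in> hidden m n H" for v using that by (auto simp: \<phi>_def hidden_def)
    have uniq: "p = q" if "p \<in> hidden m n H" "occurs_at (P n) (\<sigma> p) q" for p q
      using \<sigma>(1)[OF that(1)] \<sigma>(2)[OF that(1)] that(2) unfolding standard_var_def by blast
    \<comment> \<open>A standard variable occurs at one position only, here one outside
      \<open>D\<close>, whereas the variables in \<open>J\<close> occur in a column of
      \<open>D\<close>.\<close>
    have VnotH: "\<phi> u \<noteq> \<phi> v" if u: "u \<in> V" and v: "v \<in> hidden m n H" for u v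
    proof
      assume "\<phi> u = \<phi> v"
      then have "\<sigma> v \<in> J" using \<phi>V[OF u] \<phi>h[OF v] by simp
      from occ[OF n this] obtain p where "p \<in> {1..m} \<times> D" "occurs_at (P n) (\<sigma> v) p" by blast
      with uniq[OF v] have "v \<in> {1..m} \<times> D" by blast
      with v show False by (auto simp: hidden_def H_def)
    qed
    have inj: "inj_on \<phi> ?I"
    proof (rule inj_onI)
      fix u v assume uv: "u \<in> ?I" "v \<in> ?I" "\<phi> u = \<phi> v"
      consider "u \<in> V" "v \<in> V" | "u \<in> hidden m n H" "v \<in> hidden m n H"
        using uv VnotH by (metis UnE)
      then show "u = v"
      proof cases
        case 1
        then show ?thesis using uv(3) \<phi>V by (metis prod.collapse)
      next
        case 2
        then show ?thesis using uv(3) \<phi>h \<sigma>(2)[OF 2(2)] uniq[OF 2(1)] by simp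
      qed
    qed
    have "\<phi> v \<in> {1..num_vars (P n)}" if "v \<in> V" for v
      using \<phi>V[OF that] Jn[OF n] by auto
    moreover have "\<phi> v \<in> {1..num_vars (P n)}" if "v \<in> hidden m n H" for v
      using \<phi>h[OF that] \<sigma>(1)[OF that] by (simp add: standard_var_def)
    ultimately have im: "\<phi> ` ?I \<subseteq> {1..num_vars (P n)}" by blast
    have rates: "expo_prod ?I (\<lambda>v. intensity (P n) (\<phi> v)) = expo_prod ?I (\<lambda>v. if v \<in> V then \<rho> v (real n) else 1)"
    proof (rule expo_prod_cong)
      fix v assume v: "v \<in> ?I"
      show "intensity (P n) (\<phi> v) = (if v \<in> V then \<rho> v (real n) else 1)"
      proof (cases "v \<in> V")
        case True
        then show ?thesis using \<phi>V[OF True] f(2)[OF _ n] by (simp add: \<rho>_def)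
      next
        case False
        then have "v \<in> hidden m n H" using v by blast
        then show ?thesis using False \<phi>h \<sigma>(1) by (simp add: standard_var_def)
      qed
    qed
    have ent_entry: "ent V H A B (\<lambda>v\<in>?I. var (P n) (\<phi> v) \<omega>) p = entry (P n) p \<omega>"
      if p: "p \<in> {1..m} \<times> {1..n}" for p \<omega>
    proof -
      let ?x = "\<lambda>v\<in>?I. var (P n) (\<phi> v) \<omega>"
      consider "p \<in> {1..m} \<times> D" | "p \<in> zeros" "p \<notin> {1..m} \<times> D" | "p \<in> hidden m n H" "p \<notin> H"
        using p by (auto simp: hidden_def H_def)
      then show ?thesis
      proof cases
        case 1
        have "(\<Sum>v\<in>V. A p v * ?x v) = (\<Sum>i\<in>J. A p (0, i) * ?x (0, i))"
          unfolding V_def by (subst sum.reindex) (auto simp: inj_on_def)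
        also have "\<dots> = (\<Sum>i\<in>J. of_rat (coef (P n0) p i) * var (P n) i \<omega>)"
          using 1 by (intro sum.cong refl) (simp add: A_def V_def \<phi>_def)
        also have "\<dots> = (\<Sum>i=1..num_vars (P n). of_rat (coef (P n0) p i) * var (P n) i \<omega>)"
          using Jn[OF n] 1 by (intro sum.mono_neutral_left) (auto simp: J_def)
        also have "\<dots> = entry (P n) p \<omega>"
          using coef_eq[OF n, of p] 1 Dpos unfolding entry_def by (intro sum.cong refl) auto
        finally show ?thesis using 1 by (simp add: ent_def H_def)
      next
        case 2
        then show ?thesis using entry_zero[OF n] by (simp add: ent_def H_def A_def)
      next
        case 3
        then have "entry (P n) p \<omega> = var (P n) (\<phi> p) \<omega>" using entry_standard \<sigma> \<phi>h by metis
        with 3 show ?thesis by (simp add: ent_def B_def)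
      qed
    qed
    have cost: "sat_cost m n k D V H A B (\<lambda>v\<in>?I. var (P n) (\<phi> v) \<omega>) = min_cost (P n) \<omega>"
      if "\<forall>i\<in>{1..num_vars (P n)}. 0 \<le> var (P n) i \<omega>" for \<omega>
    proof -
      let ?x = "\<lambda>v\<in>?I. var (P n) (\<phi> v) \<omega>"
      have "Min ((\<lambda>S. \<Sum>p\<in>S. entry (P n) p \<omega>) ` assignments_in m n k) =
        Min ((\<lambda>S. \<Sum>p\<in>S. entry (P n) p \<omega>) ` saturating m n k D)"
      proof (rule Min_image_dominated[OF finite_assignments_in])
        show "saturating m n k D \<subseteq> assignments_in m n k" by (auto simp: saturating_def)
        show "saturating m n k D \<noteq> {}" using sat saturating_mono[OF n] by blast
        fix S assume S: "S \<in> assignments_in m n k"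
        show "\<exists>S'\<in>saturating m n k D. (\<Sum>p\<in>S'. entry (P n) p \<omega>) \<le> (\<Sum>p\<in>S. entry (P n) p \<omega>)"
        proof (rule saturate_columns[OF _ M(2,3) D_def[symmetric] _ _ _ S])
          show "M \<subseteq> {1..m} \<times> {1..n}" using M(1) zeros_subset n by fastforce
          show "0 \<le> entry (P n) p \<omega>" if "p \<in> {1..m} \<times> {1..n}" for p
            using entry_nonneg[OF rap[OF n]] positions_eq[OF n] that \<open>\<forall>i\<in>_. _\<close> by blast
          show "entry (P n) p \<omega> = 0" if "p \<in> M" for p using entry_zero[OF n] M(1) that by blast
        qed (use DM M(4) in simp)
      qed
      moreover have "(\<Sum>p\<in>S. ent V H A B ?x p) = (\<Sum>p\<in>S. entry (P n) p \<omega>)" if "S \<in> saturating m n k D" for S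
        using that by (intro sum.cong ent_entry) (auto simp: saturating_def assignments_in_def)
      then have "(\<lambda>S. \<Sum>p\<in>S. ent V H A B ?x p) ` saturating m n k D =
        (\<lambda>S. \<Sum>p\<in>S. entry (P n) p \<omega>) ` saturating m n k D" by (intro image_cong) auto
      ultimately show ?thesis
        by (simp only: sat_cost_def min_cost_def assignments_eq dims[OF n])
    qed
    have "(\<integral>\<^sup>+\<omega>. ennreal (min_cost (P n) \<omega>) \<partial>prspace (P n)) =
      (\<integral>\<^sup>+\<omega>. ennreal (sat_cost m n k D V H A B (\<lambda>v\<in>?I. var (P n) (\<phi> v) \<omega>)) \<partial>prspace (P n))"
    proof (rule nn_integral_cong_AE)
      show "AE \<omega> in prspace (P n). ennreal (min_cost (P n) \<omega>) =
          ennreal (sat_cost m n k D V H A B (\<lambda>v\<in>?I. var (P n) (\<phi> v) \<omega>))"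
        using AE_var_nonneg[OF rap[OF n]] by eventually_elim (simp only: cost)
    qed
    also have "\<dots> = sat_mean m n k D V \<rho> H A B"
      using nn_integral_vars[OF rap[OF n] inj im measurable_sat_cost[OF order_refl]]
      unfolding rates sat_mean_def .
    finally show "(\<integral>\<^sup>+\<omega>. ennreal (min_cost (P n) \<omega>) \<partial>prspace (P n)) = ennreal (g (real n))"
      using g(2)[OF n] by simp
    show "0 \<le> g (real n)" using g(2)[OF n] by blast
  qed
  with g(1) show ?thesis by blast
qed

end

theorem theorem6p3:
  fixes P :: "nat \<Rightarrow> 'a rap" and k m n0 :: nat
  assumes "well_behaved k m n0 P"
  shows "\<exists>p q :: real poly. q \<noteq> 0 \<and>
           (\<forall>x. poly q x = 0 \<longrightarrow> x < real k) \<and>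
           (\<forall>n\<ge>n0. expected_min_cost (P n) = poly p (real n) / poly q (real n))"
proof -
  interpret well_behaved_sequence P k m n0 by unfold_locales fact
  obtain M where M: "M \<subseteq> zeros" "inj_on fst M" "inj_on snd M"
    "\<And>n. n0 \<le> n \<Longrightarrow> column_maximal_columns (P n) \<subseteq> snd ` M"
    using maximum_zero_matching by blast
  have "\<exists>f. rational_from (real k) f \<and> (\<forall>n\<ge>n0. expected_min_cost (P n) = f (real n))"
  \<comment> \<open>With \<open>k\<close> zeros in a matching the cost vanishes; the exchange with
    \<open>M\<close> is available when \<open>card D \<le> k\<close>.\<close>
  proof (cases "k \<le> card M")
    case True
    then show ?thesis
      using expected_min_cost_zero[OF M(1-3)] rational_from_const[of "real k" 0] by blast
  next
    case False
    then show ?thesis by (intro expected_min_cost_rational[OF M(1-3) _ M(4)]) auto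
  qed
  \<comment> \<open>Since \<open>k \<le> n0\<close>, every \<open>n \<ge> n0\<close> lies on the ray
    on which the quotient represents \<open>f\<close>.\<close>
  then obtain p q where pq: "\<And>x. x \<ge> real k \<Longrightarrow> 0 < poly q x"
    "\<And>n. n \<ge> n0 \<Longrightarrow> expected_min_cost (P n) = poly p (real n) / poly q (real n)"
    using k_le(2) unfolding rational_from_def by (metis of_nat_le_iff order_trans)
  have "q \<noteq> 0" using pq(1)[of "real k"] by auto
  moreover have "x < real k" if "poly q x = 0" for x using pq(1)[of x] that by force
  ultimately show ?thesis using pq(2) by blast
qed

end
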